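(* Let $f$ be the generalized hyperbolic density with parameters $\mu,\lambda,\alpha,\beta,\delta$, that is, the probability density on $\mathbf{R}$ with $$f(y)\propto e^{\beta(y-\mu)}\left(\delta^2+(y-\mu)^2\right)^{(\lambda-1/2)/2}K_{\lambda-1/2}\left(\alpha\sqrt{\delta^2+(y-\mu)^2}\right),\quad y\in\mathbf{R},$$ where $K_\nu$ is the modified Bessel function of the second kind, $\mu,\lambda\in\mathbf{R}$, and the remaining parameters satisfy: $\delta\ge 0$, $|\beta|<\alpha$ if $\lambda>0$; $\delta>0$, $|\beta|<\alpha$ if $\lambda=0$; $\delta>0$, $|\beta|\le\alpha$ if $\lambda<0$. Then: (i) The density $f$ is unimodal. (ii) The mode of $f$ is at $\mu$ if and only if either $\beta=0$, or $\delta=0$ and $0<\lambda\le 1$. (iii) The density $f$ is log-concave if and only if $\lambda\ge 1$. (iv) The density $f$ is log-convex on each of $(-\infty,\mu)$ and $(\mu,\infty)$ if and only if $\delta=0$ and $0<\lambda\le 1$.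
   Context: Boundary cases of the formula are understood as limits: when $\delta=0$ (so $\lambda>0$), the value $f(\mu)$ is the limit of $f(y)$ as $y\to\mu$ (finite if $\lambda>1/2$, equal to $+\infty$ if $0<\lambda\le 1/2$); when $\alpha=0$ (so $\lambda<0$, $\beta=0$), $f(y)\propto(\delta^2+(y-\mu)^2)^{\lambda-1/2}$. A function $f$ on $\mathbf{R}$ is unimodal if there exists $x_*\in\mathbf{R}$ such that $f$ increases (non-strictly) on $(-\infty,x_*]$ and decreases (non-strictly) on $[x_*,\infty)$; such a point $x_*$ is a mode of $f$. A nonnegative function $f$ on $\mathbf{R}$ is log-concave if $f(\theta x+(1-\theta)y)\ge[f(x)]^\theta[f(y)]^{1-\theta}$ for all $x,y\in\mathbf{R}$, $\theta\in(0,1)$. A positive function $f$ on an interval $I$ is log-convex on $I$ if $\log f$ is convex on $I$. *)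

theory Defs
  imports "HOL-Analysis.Analysis"
begin

(* The standard integral representation of the modified Bessel function of the second kind,
   for real order and x > 0; the value for x \<le> 0 is meaningless and is never used below. *)
definition bessel_K :: "real \<Rightarrow> real \<Rightarrow> real" where
  "bessel_K nu x = (LINT t:{0..}|lborel. exp (- x * cosh t) * cosh (nu * t))"

(* For \<alpha> = 0 (which forces \<beta> = 0 and lam < 0) the first branch is the limit, as \<alpha> \<rightarrow> 0, of the
   second one up to a factor independent of y. The value at y = \<mu> when \<delta> = 0 is meaningless
   and not used in gh_density. *)
definition gh_kernel :: "real \<Rightarrow> real \<Rightarrow> real \<Rightarrow> real \<Rightarrow> real \<Rightarrow> real \<Rightarrow> real" where
  "gh_kernel \<mu> lam \<alpha> \<beta> \<delta> y =
     (if \<alpha> = 0 then (\<delta>\<^sup>2 + (y - \<mu>)\<^sup>2) powr (lam - 1/2)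
      else exp (\<beta> * (y - \<mu>)) * (\<delta>\<^sup>2 + (y - \<mu>)\<^sup>2) powr ((lam - 1/2) / 2)
             * bessel_K (lam - 1/2) (\<alpha> * sqrt (\<delta>\<^sup>2 + (y - \<mu>)\<^sup>2)))"

(* Values lie in [0, \<infinity>]: if \<delta> = 0, then f \<mu> is the limit of f at \<mu>, which is
   infinite for 0 < lam \<le> 1/2. *)
definition gh_density ::
    "real \<Rightarrow> real \<Rightarrow> real \<Rightarrow> real \<Rightarrow> real \<Rightarrow> (real \<Rightarrow> ennreal) \<Rightarrow> bool" where
  "gh_density \<mu> lam \<alpha> \<beta> \<delta> f \<longleftrightarrow>
     f \<in> borel_measurable borel \<and> (\<integral>\<^sup>+ y. f y \<partial>lborel) = 1 \<and>
     (\<exists>c>0. \<forall>y. \<delta> \<noteq> 0 \<or> y \<noteq> \<mu> \<longrightarrow> f y = ennreal (c * gh_kernel \<mu> lam \<alpha> \<beta> \<delta> y)) \<and>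
     (\<delta> = 0 \<longrightarrow> (f \<longlongrightarrow> f \<mu>) (at \<mu>))"

definition is_mode :: "(real \<Rightarrow> ennreal) \<Rightarrow> real \<Rightarrow> bool" where
  "is_mode f x \<longleftrightarrow> mono_on {..x} f \<and> antimono_on {x..} f"

definition unimodal :: "(real \<Rightarrow> ennreal) \<Rightarrow> bool" where
  "unimodal f \<longleftrightarrow> (\<exists>x. is_mode f x)"

(* Real power on [0, \<infinity>], for exponents p > 0 only. *)
definition ennreal_power :: "ennreal \<Rightarrow> real \<Rightarrow> ennreal" where
  "ennreal_power a p = (if a = \<infinity> then \<infinity> else ennreal (enn2real a powr p))"

definition log_concave_fun :: "(real \<Rightarrow> ennreal) \<Rightarrow> bool" where
  "log_concave_fun f \<longleftrightarrow>
     (\<forall>x y. \<forall>\<theta>\<in>{0<..<1}.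
        f (\<theta> * x + (1 - \<theta>) * y) \<ge> ennreal_power (f x) \<theta> * ennreal_power (f y) (1 - \<theta>))"

definition log_convex_on :: "real set \<Rightarrow> (real \<Rightarrow> ennreal) \<Rightarrow> bool" where
  "log_convex_on I f \<longleftrightarrow>
     (\<forall>x\<in>I. 0 < f x \<and> f x < \<infinity>) \<and> convex_on I (\<lambda>x. ln (enn2real (f x)))"

end

theory Submission
  imports Defs
begin

text \<open>
  Write \<open>\<nu> = \<lambda> - 1/2\<close>, \<open>r = sqrt (\<delta>\<^sup>2 + y\<^sup>2)\<close>, \<open>\<rho> = K\<^sub>\<nu>\<^sub>-\<^sub>1 / K\<^sub>\<nu>\<close>. The logarithmic derivative of the density at
  \<open>\<mu> \<plusminus> y\<close> (\<open>y > 0\<close>, with respect to \<open>y\<close>) is \<open>\<plusminus> \<beta> - \<alpha> P(y)\<close>, where \<open>P(y) = (y / r) \<rho>(\<alpha> r)\<close>. Hence the four claims are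
  statements about \<open>P\<close>: log-concavity and log-convexity mean that \<open>P\<close> increases or decreases, the mode is
  at \<open>\<mu>\<close> iff \<open>\<alpha> P \<ge> |\<beta>|\<close>, and the density is unimodal if \<open>P\<close> crosses the level \<open>|\<beta>| / \<alpha> \<le> 1\<close> only upwards.

  Both \<open>\<rho>\<close> and \<open>P\<close> tend to 1 (by Turan's inequality \<open>K\<^sub>\<nu>\<^sup>2 \<le> K\<^sub>\<nu>\<^sub>+\<^sub>1 K\<^sub>\<nu>\<^sub>-\<^sub>1\<close>) and satisfy Riccati
  equations. At a critical point of \<open>\<rho>\<close>, or of \<open>P\<close> where \<open>P \<le> 1\<close> and \<open>\<lambda> \<le> 1\<close>, these equations determine the sign
  of the second derivative. Therefore a derivative of the wrong sign would persist up to infinity and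
  contradict the limit.
\<close>

section \<open>Modified Bessel functions of the second kind\<close>

lemma exp_minus_set_integrable: "set_integrable lborel {0..} (\<lambda>t::real. exp (- t))"
proof -
  have "(\<lambda>t::real. exp (-1 * t)) absolutely_integrable_on {0..}"
    using integrable_on_exp_minus_to_infinity[of 1 0]
    by (intro nonnegative_absolutely_integrable_1) auto
  then show ?thesis
    unfolding set_integrable_def by (simp add: integrable_completion)
qed

text \<open>Quadratic growth suffices later: it absorbs the linear exponent coming from
  \<open>cosh (nu * t)\<close> once a square is completed.\<close>

lemma cosh_ge_square: "t\<^sup>2 / 4 \<le> cosh (t::real)"
proof -
  have "t\<^sup>2 / 2 \<le> exp \<bar>t\<bar>"
    using exp_lower_Taylor_quadratic[of "\<bar>t\<bar>"] by simp
  moreover have "exp \<bar>t\<bar> / 2 \<le> cosh t"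
    using exp_ge_zero[of t] exp_ge_zero[of "-t"] by (auto simp: cosh_field_def abs_if)
  ultimately show ?thesis by simp
qed

lemma cosh_le_exp_abs: "cosh (t::real) \<le> exp \<bar>t\<bar>"
  by (auto simp: cosh_field_def abs_if)

text \<open>The majorant serves twice: for integrability of the defining integral, and for the decay
  of the boundary term when integrating by parts.\<close>

lemma bessel_integrand_le:
  fixes x nu t :: real
  assumes "x > 0" "t \<ge> 0"
  shows "exp (- x * cosh t) * cosh (nu * t) \<le> exp ((\<bar>nu\<bar> + 1)\<^sup>2 / x) * exp (- t)"
proof -
  \<comment> \<open>Completing the square with \<open>\<bar>nu\<bar> + 1\<close> instead of
    \<open>\<bar>nu\<bar>\<close> leaves the decaying factor \<open>exp (- t)\<close> over.\<close>
  have "0 \<le> (sqrt x * t / 2 - (\<bar>nu\<bar> + 1) / sqrt x)\<^sup>2" by simp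
  also have "\<dots> = x * t\<^sup>2 / 4 - (\<bar>nu\<bar> + 1) * t + (\<bar>nu\<bar> + 1)\<^sup>2 / x"
    using assms by (simp add: power2_diff power_divide power_mult_distrib)
  finally have "- x * (t\<^sup>2 / 4) + \<bar>nu\<bar> * t \<le> (\<bar>nu\<bar> + 1)\<^sup>2 / x + (- t)"
    by (simp add: algebra_simps)
  moreover have "- x * cosh t \<le> - x * (t\<^sup>2 / 4)"
    using mult_left_mono[OF cosh_ge_square[of t], of x] assms by simp
  ultimately have "- x * cosh t + \<bar>nu\<bar> * t \<le> (\<bar>nu\<bar> + 1)\<^sup>2 / x + (- t)" by linarith
  then have "exp (- x * cosh t) * exp (\<bar>nu\<bar> * t) \<le> exp ((\<bar>nu\<bar> + 1)\<^sup>2 / x) * exp (- t)"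
    by (simp flip: exp_add)
  moreover have "exp (- x * cosh t) * cosh (nu * t) \<le> exp (- x * cosh t) * exp (\<bar>nu\<bar> * t)"
    using cosh_le_exp_abs[of "nu * t"] assms by (intro mult_left_mono) (auto simp: abs_mult)
  ultimately show ?thesis by linarith
qed

lemma bessel_integrable:
  fixes x nu :: real
  assumes "x > 0"
  shows "set_integrable lborel {0..} (\<lambda>t. exp (- x * cosh t) * cosh (nu * t))"
proof -
  have "set_integrable lborel {0..} (\<lambda>t. exp ((\<bar>nu\<bar> + 1)\<^sup>2 / x) * exp (- t))"
    by (intro set_integrable_mult_right exp_minus_set_integrable)
  then show ?thesis
  proof (rule set_integrable_bound)
    show "set_borel_measurable lborel {0..} (\<lambda>t. exp (- x * cosh t) * cosh (nu * t))"
      unfolding set_borel_measurable_def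
      by (intro borel_measurable_scaleR borel_measurable_indicator)
         (auto intro!: borel_measurable_continuous_onI continuous_intros)
  qed (use bessel_integrand_le[OF assms] in \<open>auto simp: abs_mult\<close>)
qed

lemma bessel_K_minus [simp]: "bessel_K (- nu) x = bessel_K nu x"
  by (simp add: bessel_K_def)

lemma bessel_K_pos:
  assumes "x > 0"
  shows "bessel_K nu x > 0"
proof -
  let ?g = "\<lambda>t::real. indicator {0..} t *\<^sub>R (exp (- x * cosh t) * cosh (nu * t))"
  have int: "integrable lborel ?g"
    using bessel_integrable[OF assms] by (simp add: set_integrable_def)
  have "bessel_K nu x \<ge> 0"
    unfolding bessel_K_def set_lebesgue_integral_def by (intro integral_nonneg_AE) auto
  moreover have "bessel_K nu x \<noteq> 0"
  proof
    assume "bessel_K nu x = 0"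
    then have "AE t in lborel. ?g t = 0"
      using integral_nonneg_eq_0_iff_AE[OF int]
      by (auto simp: bessel_K_def set_lebesgue_integral_def)
    \<comment> \<open>The integrand is strictly positive on \<open>{0..}\<close>, so its vanishing
      almost everywhere would make even \<open>{0..1}\<close> a null set.\<close>
    then have "AE t in lborel. t \<notin> {0..1::real}"
      by eventually_elim (auto simp: indicator_def split: if_splits)
    then have "emeasure lborel {0..1::real} = 0"
      by (subst (asm) AE_iff_measurable[of "{0..1}"]) auto
    then show False by simp
  qed
  ultimately show ?thesis by linarith
qed

section \<open>Convexity and differentiability in the argument\<close>

text \<open>For fixed \<open>s\<close> the integrand is the exponential of a linear function of the
  argument, with positive weight \<open>cosh (nu * s)\<close>. Continuity will be drawn from this
  convexity.\<close>

lemma bessel_K_convex: "convex_on {0<..} (bessel_K nu)"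
proof (rule convex_onI)
  fix t x y :: real assume t: "0 < t" "t < 1" and "x \<in> {0<..}" "y \<in> {0<..}"
  then have x: "x > 0" and y: "y > 0" by auto
  have p: "(1 - t) * x + t * y > 0" using t x y by (simp add: add_pos_pos)
  have le: "exp (- ((1 - t) * x + t * y) * cosh s) * cosh (nu * s)
      \<le> (1 - t) * (exp (- x * cosh s) * cosh (nu * s)) + t * (exp (- y * cosh s) * cosh (nu * s))" for s
  proof -
    have "exp ((1 - t) *\<^sub>R (- x * cosh s) + t *\<^sub>R (- y * cosh s))
        \<le> (1 - t) * exp (- x * cosh s) + t * exp (- y * cosh s)"
      using convex_onD[OF exp_convex, of t "- x * cosh s" "- y * cosh s"] t by auto
    from mult_right_mono[OF this, of "cosh (nu * s)"] show ?thesis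
      by (simp add: algebra_simps)
  qed
  have "bessel_K nu ((1 - t) * x + t * y) \<le>
    (LINT s:{0..}|lborel. (1 - t) * (exp (- x * cosh s) * cosh (nu * s)) + t * (exp (- y * cosh s) * cosh (nu * s)))"
    unfolding bessel_K_def using le
    by (intro set_integral_mono set_integral_add set_integrable_mult_right bessel_integrable p x y) auto
  also have "\<dots> = (1 - t) * bessel_K nu x + t * bessel_K nu y"
    unfolding bessel_K_def
    using set_integrable_mult_right[OF bessel_integrable[OF x, of nu], of "1 - t"]
      set_integrable_mult_right[OF bessel_integrable[OF y, of nu], of t]
    by (subst set_integral_add) auto
  finally show "bessel_K nu ((1 - t) *\<^sub>R x + t *\<^sub>R y) \<le> (1 - t) * bessel_K nu x + t * bessel_K nu y"
    by simp
qed auto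

lemma isCont_bessel_K: "x > 0 \<Longrightarrow> isCont (bessel_K nu) x"
  using convex_on_continuous[OF _ bessel_K_convex, of nu]
  by (simp add: continuous_on_eq_continuous_at)

text \<open>The factor \<open>cosh t\<close>, produced by formally differentiating in
  \<open>x\<close>, is turned by the product-to-sum formula into the average of the two neighbouring
  orders.\<close>

lemma bessel_K_cosh_integral:
  fixes x nu :: real
  assumes "x > 0"
  shows "set_integrable lborel {0..} (\<lambda>t. exp (- x * cosh t) * (cosh t * cosh (nu * t)))" (is ?I)
    and "(LINT t:{0..}|lborel. exp (- x * cosh t) * (cosh t * cosh (nu * t))) =
      (bessel_K (nu + 1) x + bessel_K (nu - 1) x) / 2" (is ?E)
proof -
  let ?f = "\<lambda>n t. exp (- x * cosh t) * cosh (n * t)"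
  have eq: "exp (- x * cosh t) * (cosh t * cosh (nu * t)) = (?f (nu + 1) t + ?f (nu - 1) t) / 2" for t
    by (simp add: distrib_right left_diff_distrib cosh_add cosh_diff algebra_simps)
  note i = bessel_integrable[OF assms]
  show ?I unfolding eq by (intro set_integrable_divide set_integral_add i)
  show ?E unfolding eq bessel_K_def set_integral_divide_zero set_integral_add(2)[OF i i] ..
qed

text \<open>Integrate \<open>1 + u \<le> exp u\<close> at \<open>u = - (y - x) * cosh t\<close>. The
  formal derivative is thus a subgradient at every point.\<close>

lemma bessel_K_ge_tangent:
  assumes "x > 0" "y > 0"
  shows "bessel_K nu x - (y - x) * ((bessel_K (nu + 1) x + bessel_K (nu - 1) x) / 2) \<le> bessel_K nu y"
proof -
  have le: "exp (- x * cosh t) * cosh (nu * t) - (y - x) * (exp (- x * cosh t) * (cosh t * cosh (nu * t)))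
      \<le> exp (- y * cosh t) * cosh (nu * t)" for t
  proof -
    have "exp (- x * cosh t) * (1 + (- (y - x) * cosh t)) \<le> exp (- x * cosh t) * exp (- (y - x) * cosh t)"
      by (intro mult_left_mono exp_ge_add_one_self) auto
    also have "\<dots> = exp (- y * cosh t)"
      by (simp add: algebra_simps flip: exp_add)
    finally show ?thesis
      using mult_right_mono[of _ "exp (- y * cosh t)" "cosh (nu * t)"] by (fastforce simp: algebra_simps)
  qed
  note i = bessel_integrable[OF assms(1)] bessel_K_cosh_integral(1)[OF assms(1)]
  have "bessel_K nu x - (y - x) * ((bessel_K (nu + 1) x + bessel_K (nu - 1) x) / 2) =
    (LINT t:{0..}|lborel. exp (- x * cosh t) * cosh (nu * t) - (y - x) * (exp (- x * cosh t) * (cosh t * cosh (nu * t))))"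
    by (simp only: bessel_K_def[of nu x] set_integral_diff(2) set_integral_mult_right
        bessel_K_cosh_integral(2)[OF assms(1)] set_integrable_mult_right i)
  also have "\<dots> \<le> bessel_K nu y"
    unfolding bessel_K_def using le
    by (intro set_integral_mono set_integral_diff set_integrable_mult_right i bessel_integrable assms) auto
  finally show ?thesis .
qed

text \<open>By convexity, the difference quotient is squeezed between the slopes of the tangents at its two
  end points, so no differentiation under the integral is needed.\<close>

lemma DERIV_bessel_K_avg:
  assumes x: "x > 0"
  shows "(bessel_K nu has_real_derivative - ((bessel_K (nu + 1) x + bessel_K (nu - 1) x) / 2)) (at x)"
proof -
  let ?J = "\<lambda>z. (bessel_K (nu + 1) z + bessel_K (nu - 1) z) / 2"
  have "(?J \<longlongrightarrow> ?J x) (at x)"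
    using isCont_bessel_K[OF x] by (intro tendsto_intros) (auto simp: isCont_def)
  then have J: "((\<lambda>y. \<bar>?J y - ?J x\<bar>) \<longlongrightarrow> 0) (at x)"
    by (intro tendsto_rabs_zero) (simp add: LIM_zero_iff)
  have "\<forall>\<^sub>F y in at x. y \<in> {0<..}"
    using x by (intro eventually_at_in_open') auto
  moreover have "\<forall>\<^sub>F y in at x. y \<noteq> x" by (simp add: eventually_at_filter)
  ultimately have ev: "\<forall>\<^sub>F y in at x. norm ((bessel_K nu y - bessel_K nu x) / (y - x) - - ?J x) \<le> \<bar>?J y - ?J x\<bar>"
  proof eventually_elim
    case (elim y)
    let ?d = "bessel_K nu y - bessel_K nu x + (y - x) * ?J x"
    have "0 \<le> ?d" "?d \<le> (y - x) * (?J x - ?J y)"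
      using bessel_K_ge_tangent[of x y nu] bessel_K_ge_tangent[of y x nu] elim x
      by (auto simp: algebra_simps add_divide_distrib diff_divide_distrib)
    then have "\<bar>?d\<bar> \<le> \<bar>(y - x) * (?J x - ?J y)\<bar>" by linarith
    then have "\<bar>?d\<bar> / \<bar>y - x\<bar> \<le> \<bar>?J x - ?J y\<bar>"
      using elim by (simp add: abs_mult divide_simps mult.commute)
    moreover have "(bessel_K nu y - bessel_K nu x) / (y - x) - - ?J x = ?d / (y - x)"
      using elim by (simp add: add_divide_distrib)
    ultimately show ?case by (simp only: real_norm_def abs_divide abs_minus_commute[of "?J y"])
  qed
  have "((\<lambda>y. (bessel_K nu y - bessel_K nu x) / (y - x) - - ?J x) \<longlongrightarrow> 0) (at x)"
    by (rule Lim_null_comparison[OF ev J])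
  then show ?thesis
    by (simp only: has_field_derivative_iff LIM_zero_iff)
qed

section \<open>Recurrence in the order and the Turan inequality\<close>

text \<open>Integration by parts: \<open>?g\<close> is the derivative of \<open>?F\<close>, whose
  boundary values at 0 and at infinity both vanish, so the integral of \<open>?g\<close> is
  0.\<close>

lemma bessel_K_recurrence:
  assumes x: "x > 0"
  shows "x * (bessel_K (nu + 1) x - bessel_K (nu - 1) x) = 2 * nu * bessel_K nu x"
proof -
  let ?f = "\<lambda>n t. exp (- x * cosh t) * cosh (n * t)"
  let ?F = "\<lambda>t. - exp (- x * cosh t) * sinh (nu * t)"
  let ?g = "\<lambda>t. x / 2 * (?f (nu + 1) t - ?f (nu - 1) t) - nu * ?f nu t"
  note i = bessel_integrable[OF x]
  have int: "set_integrable lborel {0..} ?g"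
    by (intro set_integral_diff set_integrable_mult_right i)
  \<comment> \<open>\<open>sinh t * sinh (nu * t)\<close> is half the difference of
    \<open>cosh ((nu + 1) * t)\<close> and \<open>cosh ((nu - 1) * t)\<close>.\<close>
  have eq: "?g t = x * sinh t * exp (- x * cosh t) * sinh (nu * t) - nu * ?f nu t" for t
    by (simp add: distrib_right left_diff_distrib cosh_add cosh_diff algebra_simps)
  have "(LBINT t=ereal 0..\<infinity>. ?g t) = 0 - 0"
  proof (rule interval_integral_FTC_integrable[where F = ?F])
    show "(?F has_vector_derivative ?g t) (at t)" for t
      unfolding eq has_real_derivative_iff_has_vector_derivative[symmetric]
      by (auto intro!: derivative_eq_intros)
    show "isCont ?g t" for t by (intro continuous_intros)
    show "set_integrable lborel (einterval (ereal 0) \<infinity>) ?g"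
      by (rule set_integrable_subset[OF int]) auto
    have "(?F \<longlongrightarrow> ?F 0) (at_right 0)"
      by (intro tendsto_intros)
    then show "((?F \<circ> real_of_ereal) \<longlongrightarrow> 0) (at_right (ereal 0))"
      by (simp add: ereal_tendsto_simps)
    have "((\<lambda>t::real. exp ((\<bar>nu\<bar> + 1)\<^sup>2 / x) * exp (- t)) \<longlongrightarrow> 0) at_top"
      by (intro tendsto_mult_right_zero)
        (rule filterlim_compose[OF exp_at_bot filterlim_uminus_at_bot_at_top])
    moreover have "\<forall>\<^sub>F t in at_top. norm (?F t) \<le> exp ((\<bar>nu\<bar> + 1)\<^sup>2 / x) * exp (- t)"
      using eventually_ge_at_top[of 0]
    proof eventually_elim
      case (elim t)
      have "\<bar>sinh (nu * t)\<bar> \<le> cosh (nu * t)"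
        using sinh_le_cosh_real[of "nu * t"] sinh_le_cosh_real[of "- (nu * t)"] by auto
      then have "norm (?F t) \<le> exp (- x * cosh t) * cosh (nu * t)"
        by (simp add: abs_mult)
      also have "\<dots> \<le> exp ((\<bar>nu\<bar> + 1)\<^sup>2 / x) * exp (- t)"
        by (rule bessel_integrand_le[OF x elim])
      finally show ?case .
    qed
    ultimately have "(?F \<longlongrightarrow> 0) at_top"
      by (rule Lim_null_comparison[rotated])
    then show "((?F \<circ> real_of_ereal) \<longlongrightarrow> 0) (at_left \<infinity>)"
      by (simp add: ereal_tendsto_simps)
  qed auto
  also have "(LBINT t=ereal 0..\<infinity>. ?g t) = (LBINT t:{0..}. ?g t)"
    unfolding interval_integral_to_infinity_eq
    by (rule set_integral_discrete_difference[where X="{0}"]) auto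
  also have "\<dots> = x / 2 * (bessel_K (nu + 1) x - bessel_K (nu - 1) x) - nu * bessel_K nu x"
    by (simp only: bessel_K_def set_integral_diff set_integral_mult_right
         set_integrable_mult_right i)
  finally show ?thesis by simp
qed

text \<open>Eliminating order \<open>nu + 1\<close> by the recurrence leaves only the orders
  \<open>nu\<close> and \<open>nu - 1\<close>, which makes a closed equation for their ratio
  possible.\<close>

lemma DERIV_bessel_K:
  assumes x: "x > 0"
  shows "(bessel_K nu has_real_derivative - bessel_K (nu - 1) x - nu / x * bessel_K nu x) (at x)"
proof -
  have "bessel_K (nu + 1) x = bessel_K (nu - 1) x + 2 * nu / x * bessel_K nu x"
    using bessel_K_recurrence[OF x, of nu] x by (simp add: field_simps)
  then have "- ((bessel_K (nu + 1) x + bessel_K (nu - 1) x) / 2) = - bessel_K (nu - 1) x - nu / x * bessel_K nu x"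
    by (simp add: add_divide_distrib)
  with DERIV_bessel_K_avg[OF x, of nu] show ?thesis by (simp only:)
qed

text \<open>Cauchy-Schwarz in disguise: the three neighbouring orders supply the coefficients of a
  quadratic polynomial that is nonnegative everywhere, in particular at its minimum.\<close>

lemma bessel_K_turan:
  assumes x: "x > 0"
  shows "(bessel_K nu x)\<^sup>2 \<le> bessel_K (nu + 1) x * bessel_K (nu - 1) x"
proof -
  \<comment> \<open>minimizes the integral of \<open>?g\<close>, a quadratic polynomial in \<open>s\<close>\<close>
  define s where "s = bessel_K nu x / bessel_K (nu - 1) x"
  let ?f = "\<lambda>n t. exp (- x * cosh t) * cosh (n * t)"
  let ?g = "\<lambda>t. ?f (nu + 1) t - 2 * s * ?f nu t + s\<^sup>2 * ?f (nu - 1) t"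
  note i = bessel_integrable[OF x]
  have nn: "0 \<le> ?g t" for t
  proof -
    \<comment> \<open>In exponentials the integrand splits into a part with weight
      \<open>exp (nu * t)\<close> and a part with weight \<open>exp (- nu * t)\<close>, each a
      positive multiple of a square.\<close>
    define p q where "p = exp (t / 2)" and "q = exp (nu * t)"
    have pq: "p > 0" "q > 0" by (auto simp: p_def q_def)
    have e: "exp t = p\<^sup>2" by (simp add: p_def power2_eq_square flip: exp_add)
    have "cosh ((nu + 1) * t) = (q * p\<^sup>2 + 1 / (q * p\<^sup>2)) / 2"
         "cosh ((nu - 1) * t) = (q / p\<^sup>2 + p\<^sup>2 / q) / 2" "cosh (nu * t) = (q + 1 / q) / 2"
      by (simp_all add: cosh_field_def distrib_right left_diff_distrib exp_add exp_diff exp_minus e q_def field_simps)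
    moreover have "E * ((q * p\<^sup>2 + 1 / (q * p\<^sup>2)) / 2) - 2 * s * (E * ((q + 1 / q) / 2))
        + s\<^sup>2 * (E * ((q / p\<^sup>2 + p\<^sup>2 / q) / 2)) = E / 2 * (q * (p - s / p)\<^sup>2 + (1 / p - s * p)\<^sup>2 / q)" for E
      using pq by (simp add: field_simps power2_eq_square)
    moreover have "0 \<le> exp (- x * cosh t) / 2 * (q * (p - s / p)\<^sup>2 + (1 / p - s * p)\<^sup>2 / q)"
      using pq by simp
    ultimately show ?thesis by (simp only:)
  qed
  have "0 \<le> (LINT t:{0..}|lborel. ?g t)"
    unfolding set_lebesgue_integral_def using nn by (intro integral_nonneg_AE) auto
  also have "\<dots> = bessel_K (nu + 1) x - 2 * s * bessel_K nu x + s\<^sup>2 * bessel_K (nu - 1) x"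
    by (simp only: bessel_K_def set_integral_diff set_integral_add set_integral_mult_right
         set_integrable_mult_right i)
  also have "\<dots> = bessel_K (nu + 1) x - (bessel_K nu x)\<^sup>2 / bessel_K (nu - 1) x"
    using bessel_K_pos[OF x, of "nu - 1"] by (simp add: s_def power2_eq_square field_simps)
  finally show ?thesis
    using bessel_K_pos[OF x, of "nu - 1"] by (simp add: field_simps)
qed

section \<open>Ratios of consecutive orders\<close>

definition bessel_ratio :: "real \<Rightarrow> real \<Rightarrow> real" where
  "bessel_ratio nu z = bessel_K (nu - 1) z / bessel_K nu z"

lemma bessel_ratio_pos: "z > 0 \<Longrightarrow> bessel_ratio nu z > 0"
  by (simp add: bessel_ratio_def bessel_K_pos)

text \<open>Evenness of \<open>bessel_K\<close> in the order makes the two orders coincide. This is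
  the case \<open>lam = 1\<close>, which separates decreasing from increasing ratios.\<close>

lemma bessel_ratio_half: "z > 0 \<Longrightarrow> bessel_ratio (1/2) z = 1"
  using bessel_K_minus[of "1/2" z] bessel_K_pos[of z "1/2"] by (simp add: bessel_ratio_def)

text \<open>The Riccati equation: the recurrence expresses order \<open>nu - 2\<close> through
  \<open>nu\<close> and \<open>nu - 1\<close>, so the quotient rule closes up in the ratio
  alone.\<close>

lemma DERIV_bessel_ratio:
  assumes z: "z > 0"
  shows "(bessel_ratio nu has_real_derivative
    (bessel_ratio nu z)\<^sup>2 - 1 + (2 * nu - 1) * bessel_ratio nu z / z) (at z)"
proof -
  let ?K = "bessel_K nu z" and ?L = "bessel_K (nu - 1) z"
  have K: "?K > 0" using z by (rule bessel_K_pos)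
  have "bessel_K (nu - 1 - 1) z = ?K - 2 * (nu - 1) / z * ?L"
    using bessel_K_recurrence[OF z, of "nu - 1"] z by (simp add: field_simps)
  then have dL: "(bessel_K (nu - 1) has_real_derivative (nu - 1) / z * ?L - ?K) (at z)"
    by (intro DERIV_cong[OF DERIV_bessel_K[OF z, of "nu - 1"]]) (simp add: field_simps)
  have "((\<lambda>z. bessel_K (nu - 1) z / bessel_K nu z) has_real_derivative
     (((nu - 1) / z * ?L - ?K) * ?K - ?L * (- ?L - nu / z * ?K)) / (?K * ?K)) (at z)"
    using K by (intro DERIV_divide dL DERIV_bessel_K z) auto
  moreover have "(((nu - 1) / z * ?L - ?K) * ?K - ?L * (- ?L - nu / z * ?K)) / (?K * ?K)
     = (?L / ?K)\<^sup>2 - 1 + (2 * nu - 1) * (?L / ?K) / z"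
    using K z by (simp add: field_simps power2_eq_square)
  ultimately show ?thesis unfolding bessel_ratio_def by (simp only:)
qed

text \<open>Turan's inequality at order \<open>nu\<close> and at order \<open>nu - 1\<close>; in
  each the outermost order is eliminated by the recurrence, and the result is divided by
  \<open>(bessel_K nu z)\<^sup>2\<close>.\<close>

lemma bessel_ratio_bounds:
  assumes z: "z > 0"
  shows "1 \<le> (bessel_ratio nu z)\<^sup>2 + 2 * nu * bessel_ratio nu z / z"
    and "(bessel_ratio nu z)\<^sup>2 + 2 * (nu - 1) * bessel_ratio nu z / z \<le> 1"
proof -
  let ?K = "bessel_K nu z" and ?L = "bessel_K (nu - 1) z"
  have K: "?K > 0" using z by (rule bessel_K_pos)
  have "bessel_K (nu + 1) z = ?L + 2 * nu / z * ?K"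
    using bessel_K_recurrence[OF z, of nu] z by (simp add: field_simps)
  with bessel_K_turan[OF z, of nu] have "?K\<^sup>2 \<le> (?L + 2 * nu / z * ?K) * ?L" by simp
  from divide_right_mono[OF this, of "?K\<^sup>2"]
  show "1 \<le> (bessel_ratio nu z)\<^sup>2 + 2 * nu * bessel_ratio nu z / z"
    using K z by (simp add: bessel_ratio_def field_simps power2_eq_square)
  have "bessel_K (nu - 1 - 1) z = ?K - 2 * (nu - 1) / z * ?L"
    using bessel_K_recurrence[OF z, of "nu - 1"] z by (simp add: field_simps)
  with bessel_K_turan[OF z, of "nu - 1"] have "?L\<^sup>2 \<le> ?K * (?K - 2 * (nu - 1) / z * ?L)" by simp
  from divide_right_mono[OF this, of "?K\<^sup>2"]
  show "(bessel_ratio nu z)\<^sup>2 + 2 * (nu - 1) * bessel_ratio nu z / z \<le> 1"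
    using K z by (simp add: bessel_ratio_def field_simps power2_eq_square)
qed

text \<open>Completing squares turns the two bounds into a lower bound for the ratio shifted by
  \<open>nu / z\<close> and an upper bound for the ratio shifted by \<open>(nu - 1) / z\<close>;
  both shifts vanish at infinity.\<close>

lemma tendsto_bessel_ratio: "(bessel_ratio nu \<longlongrightarrow> 1) at_top"
proof (rule tendsto_sandwich)
  show "\<forall>\<^sub>F z in at_top. 1 - nu / z \<le> bessel_ratio nu z"
    using eventually_gt_at_top[of "\<bar>nu\<bar>"]
  proof eventually_elim
    case (elim z)
    then have z: "z > 0" by linarith
    define p where "p = bessel_ratio nu z"
    \<comment> \<open>Taking \<open>z\<close> beyond \<open>\<bar>nu\<bar>\<close> excludes the
      negative branch \<open>p + nu / z \<le> - 1\<close> of the square root.\<close>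
    have "\<bar>nu / z\<bar> < 1" using elim z by simp
    then have "0 < 1 + p + nu / z"
      using bessel_ratio_pos[OF z, of nu] unfolding p_def by linarith
    moreover have "1 \<le> (p + nu / z)\<^sup>2"
    proof -
      have "1 \<le> p\<^sup>2 + 2 * nu * p / z + (nu / z)\<^sup>2"
        using bessel_ratio_bounds(1)[OF z, of nu] unfolding p_def by (rule add_increasing2[rotated]) simp
      then show ?thesis by (simp add: power2_sum mult_ac)
    qed
    then have "1 \<le> \<bar>p + nu / z\<bar>"
      using abs_le_square_iff[of 1 "p + nu / z"] by simp
    ultimately have "1 \<le> p + nu / z" by linarith
    then show ?case by (simp add: p_def)
  qed
  show "\<forall>\<^sub>F z in at_top. bessel_ratio nu z \<le> 1 + \<bar>nu - 1\<bar> / z - (nu - 1) / z"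
    using eventually_gt_at_top[of 0]
  proof eventually_elim
    case (elim z)
    let ?q = "\<bar>nu - 1\<bar> / z"
    have "(bessel_ratio nu z + (nu - 1) / z)\<^sup>2 \<le> 1 + ?q\<^sup>2"
      using bessel_ratio_bounds(2)[OF elim, of nu] by (simp add: power2_sum power_divide algebra_simps)
    also have "\<dots> \<le> (1 + ?q)\<^sup>2"
      using elim by (simp add: power2_sum)
    finally have "bessel_ratio nu z + (nu - 1) / z \<le> 1 + ?q"
      by (rule power2_le_imp_le) (use elim in auto)
    then show ?case by simp
  qed
  show "((\<lambda>z. 1 - nu / z) \<longlongrightarrow> 1) at_top"
    using tendsto_diff[OF tendsto_const[of 1] tendsto_divide_0[OF tendsto_const[of nu] filterlim_at_top_imp_at_infinity[OF filterlim_ident]]]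
    by simp
  have "((\<lambda>z. 1 + \<bar>nu - 1\<bar> / z - (nu - 1) / z) \<longlongrightarrow> 1 + 0 - 0) at_top"
    by (intro tendsto_intros tendsto_divide_0[OF tendsto_const] filterlim_at_top_imp_at_infinity filterlim_ident)
  then show "((\<lambda>z. 1 + \<bar>nu - 1\<bar> / z - (nu - 1) / z) \<longlongrightarrow> 1) at_top" by simp
qed

section \<open>Persistence of the sign of a derivative\<close>

text \<open>Barrier argument: zero can only be crossed downwards, so there is no first return to it.
  The condition \<open>cross\<close> may use that \<open>D\<close> is nonpositive on all of
  \<open>{a..y}\<close>; the analysis of \<open>slope_ode\<close> depends on this history.\<close>

lemma stays_negative:
  fixes D D' :: "real \<Rightarrow> real"
  assumes der: "\<And>y. y \<ge> a \<Longrightarrow> (D has_real_derivative D' y) (at y)"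
    and "D a \<le> 0"
    and cross: "\<And>y. y \<ge> a \<Longrightarrow> D y = 0 \<Longrightarrow> (\<And>t. a \<le> t \<Longrightarrow> t \<le> y \<Longrightarrow> D t \<le> 0) \<Longrightarrow> D' y < 0"
    and "a < b"
  shows "D b < 0"
proof (rule ccontr)
  assume "\<not> D b < 0"
  have cont: "isCont D y" if "y \<ge> a" for y
    using der[OF that] by (rule DERIV_isCont)
  \<comment> \<open>Strict negativity just after \<open>a\<close> comes from the crossing condition
    when \<open>D a = 0\<close>, and from continuity otherwise.\<close>
  obtain d where d: "d > 0" "\<And>h. 0 < h \<Longrightarrow> h < d \<Longrightarrow> D (a + h) < 0"
  proof (cases "D a = 0")
    case True
    then have "D' a < 0" using cross[of a] by auto
    from DERIV_neg_dec_right[OF der this] True that show ?thesis by auto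
  next
    case False
    then have "\<forall>\<^sub>F y in at a. D y < 0"
      using cont[of a] \<open>D a \<le> 0\<close> by (intro order_tendstoD(2)[of _ "D a"]) (auto simp: isCont_def)
    then obtain d where "d > 0" "\<And>y. y \<noteq> a \<Longrightarrow> dist y a < d \<Longrightarrow> D y < 0"
      by (auto simp: eventually_at)
    then show ?thesis using that[of d] by (auto simp: dist_real_def)
  qed
  define a' where "a' = min (a + d / 2) b"
  have a': "a < a'" "a' \<le> b" using d(1) \<open>a < b\<close> by (auto simp: a'_def)
  have neg: "D t < 0" if "a < t" "t < a'" for t
    using d(2)[of "t - a"] that d(1) by (auto simp: a'_def)
  \<comment> \<open>The least element of \<open>S\<close> is the first return of \<open>D\<close> to
    nonnegative values; starting at \<open>a' > a\<close> keeps a possible zero at \<open>a\<close>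
    out of \<open>S\<close>.\<close>
  define S where "S = {a'..b} \<inter> D -` {0..}"
  have "b \<in> S" using \<open>\<not> D b < 0\<close> a' by (auto simp: S_def)
  moreover have "compact S"
    unfolding S_def compact_eq_bounded_closed using a' cont
    by (auto intro!: continuous_closed_preimage continuous_at_imp_continuous_on bounded_Int)
  ultimately obtain y where y: "y \<in> S" "\<And>t. t \<in> S \<Longrightarrow> y \<le> t"
    using compact_attains_inf[of S] by auto
  have ya: "a < y" "y \<le> b" "0 \<le> D y" using y(1) a' by (auto simp: S_def)
  have neg': "D t < 0" if "a < t" "t < y" for t
  proof (rule ccontr)
    assume "\<not> D t < 0"
    with neg[of t] that ya have "t \<in> S" by (force simp: S_def)
    with y(2)[of t] that show False by simp
  qed
  have "D y \<le> 0"
  proof (rule tendsto_upperbound)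
    show "(D \<longlongrightarrow> D y) (at_left y)"
      using cont[of y] ya by (auto simp: isCont_def intro: filterlim_at_split[THEN iffD1, THEN conjunct1])
    show "\<forall>\<^sub>F t in at_left y. D t \<le> 0"
      using eventually_at_left_real[OF ya(1)] by eventually_elim (use neg' in \<open>auto intro: less_imp_le\<close>)
  qed auto
  with ya have "D y = 0" by simp
  have "D t \<le> 0" if "a \<le> t" "t \<le> y" for t
    using that neg'[of t] \<open>D a \<le> 0\<close> \<open>D y = 0\<close> by (cases "t = a"; cases "t = y") auto
  \<comment> \<open>A negative derivative at the return point would make \<open>D\<close> positive
    just before it, where it is known to be negative.\<close>
  then have "D' y < 0" using cross[of y] ya \<open>D y = 0\<close> by auto
  from DERIV_neg_dec_left[OF der this] ya obtain e where e: "e > 0" "\<And>h. 0 < h \<Longrightarrow> h < e \<Longrightarrow> D y < D (y - h)"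
    by auto
  define h where "h = min (e / 2) ((y - a) / 2)"
  have "0 < h" "h < e" "h < y - a" using e(1) ya by (auto simp: h_def min_less_iff_disj)
  with e(2)[of h] neg'[of "y - h"] \<open>D y = 0\<close> show False by auto
qed

lemma decreasing_gt_limit:
  fixes F F' :: "real \<Rightarrow> real"
  assumes "\<And>y. y \<ge> b \<Longrightarrow> (F has_real_derivative F' y) (at y)" "\<And>y. y \<ge> b \<Longrightarrow> F' y < 0"
    and "(F \<longlongrightarrow> l) at_top"
  shows "F b > l"
proof -
  have dec: "F y < F x" if "b \<le> x" "x < y" for x y
  proof (rule DERIV_neg_imp_decreasing[OF that(2)])
    fix z assume "x \<le> z" "z \<le> y"
    then show "\<exists>w. (F has_real_derivative w) (at z) \<and> w < 0"
      using assms(1,2)[of z] that(1) by (intro exI[of _ "F' z"]) auto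
  qed
  \<comment> \<open>The limit yields only a weak inequality; the detour through \<open>b + 1\<close>
    makes it strict.\<close>
  have "l \<le> F (b + 1)"
  proof (rule tendsto_upperbound[OF assms(3)])
    show "\<forall>\<^sub>F y in at_top. F y \<le> F (b + 1)"
      using eventually_gt_at_top[of "b + 1"] by eventually_elim (rule less_imp_le, rule dec, auto)
  qed auto
  then show ?thesis using dec[of b "b + 1"] by simp
qed


text \<open>At a critical point the second derivative of the ratio has the sign of \<^term>\<open>1 - 2 * nu\<close>,
  so a first derivative of the wrong sign would keep that sign forever, which is incompatible with
  the Riccati equation and the limit 1.\<close>

lemma bessel_ratio_deriv_pos:
  assumes nu: "nu > 1/2" and "z > 0"
  shows "(bessel_ratio nu z)\<^sup>2 - 1 + (2 * nu - 1) * bessel_ratio nu z / z > 0"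
proof (rule ccontr)
  let ?p = "bessel_ratio nu" and ?c = "2 * nu - 1"
  define D where "D = (\<lambda>z. (?p z)\<^sup>2 - 1 + ?c * ?p z / z)"
  \<comment> \<open>The derivative of \<open>D\<close> with the Riccati equation substituted: where
    \<open>D\<close> vanishes, only \<open>- ?c * ?p z / z\<^sup>2\<close> remains.\<close>
  define D' where "D' = (\<lambda>z. 2 * ?p z * D z + ?c * (D z * z - ?p z) / z\<^sup>2)"
  have dp: "(?p has_real_derivative D y) (at y)" if "y > 0" for y
    using DERIV_bessel_ratio[OF that] by (simp add: D_def)
  have dD: "(D has_real_derivative D' y) (at y)" if "y > 0" for y
    unfolding D_def[abs_def] using that
    by (auto intro!: derivative_eq_intros dp[unfolded D_def] simp: D'_def D_def power2_eq_square)
      (simp add: field_simps)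
  assume "\<not> ?thesis"
  then have "D z \<le> 0" by (simp add: D_def)
  have neg: "D y < 0" if "y > z" for y
  proof (rule stays_negative[OF dD \<open>D z \<le> 0\<close> _ that])
    fix y assume "y \<ge> z" "D y = 0"
    then show "D' y < 0"
      using \<open>z > 0\<close> nu bessel_ratio_pos[of y nu] by (simp add: D'_def)
  qed (use \<open>z > 0\<close> in auto)
  have "?p (z + 1) > 1"
    by (rule decreasing_gt_limit[OF dp neg tendsto_bessel_ratio]) (use \<open>z > 0\<close> in auto)
  \<comment> \<open>With the ratio above 1, \<open>(?p (z + 1))\<^sup>2 - 1\<close> is positive and
    the last term is nonnegative, so \<open>D (z + 1) > 0\<close> contradicts
    \<open>neg\<close>.\<close>
  moreover have "0 \<le> ?c * ?p (z + 1) / (z + 1)"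
    using \<open>z > 0\<close> nu bessel_ratio_pos[of "z + 1" nu] by simp
  ultimately have "D (z + 1) > 0"
    using one_less_power[of "?p (z + 1)" 2] unfolding D_def by linarith
  then show False using neg[of "z + 1"] by simp
qed

lemma bessel_ratio_deriv_neg:
  assumes nu: "nu < 1/2" and "z > 0"
  shows "(bessel_ratio nu z)\<^sup>2 - 1 + (2 * nu - 1) * bessel_ratio nu z / z < 0"
proof (rule ccontr)
  let ?p = "bessel_ratio nu" and ?c = "2 * nu - 1"
  \<comment> \<open>\<open>D\<close> is the derivative of the negated ratio, so that the unwanted
    sign is again nonpositive; at its zeros \<open>D'\<close> reduces to
    \<open>?c * ?p z / z\<^sup>2\<close>, negative because \<open>?c < 0\<close>.\<close>
  define D where "D = (\<lambda>z. 1 - (?p z)\<^sup>2 - ?c * ?p z / z)"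
  define D' where "D' = (\<lambda>z. 2 * ?p z * D z + ?c * (D z * z + ?p z) / z\<^sup>2)"
  have dp: "((\<lambda>z. - ?p z) has_real_derivative D y) (at y)" if "y > 0" for y
    using DERIV_minus[OF DERIV_bessel_ratio[OF that]] by (simp add: D_def algebra_simps)
  have dp': "(?p has_real_derivative - D y) (at y)" if "y > 0" for y
    using DERIV_minus[OF dp[OF that]] by simp
  have dD: "(D has_real_derivative D' y) (at y)" if "y > 0" for y
    unfolding D_def[abs_def] using that
    by (auto intro!: derivative_eq_intros dp'[unfolded D_def] simp: D'_def D_def power2_eq_square)
      (simp add: field_simps)
  assume "\<not> ?thesis"
  then have "D z \<le> 0" by (simp add: D_def)
  have neg: "D y < 0" if "y > z" for y
  proof (rule stays_negative[OF dD \<open>D z \<le> 0\<close> _ that])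
    fix y assume "y \<ge> z" "D y = 0"
    then show "D' y < 0"
      using \<open>z > 0\<close> nu bessel_ratio_pos[of y nu] by (simp add: D'_def divide_neg_pos mult_neg_pos)
  qed (use \<open>z > 0\<close> in auto)
  have z1: "z + 1 > 0" using \<open>z > 0\<close> by simp
  have "- ?p (z + 1) > - 1"
    by (rule decreasing_gt_limit[OF dp neg tendsto_minus[OF tendsto_bessel_ratio]]) (use \<open>z > 0\<close> in auto)
  moreover have "?c * ?p (z + 1) / (z + 1) < 0"
    using z1 nu bessel_ratio_pos[OF z1, of nu] by (simp add: divide_neg_pos mult_neg_pos)
  moreover have "?p (z + 1) > 0" by (rule bessel_ratio_pos[OF z1])
  ultimately have "D (z + 1) > 0"
    using power_strict_mono[of "?p (z + 1)" 1 2] by (simp add: D_def)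
  then show False using neg[of "z + 1"] by simp
qed

section \<open>Monotonicity of the ratio and its behaviour near 0\<close>

lemma bessel_ratio_strict_mono:
  assumes "nu > 1/2" "0 < x" "x < y"
  shows "bessel_ratio nu x < bessel_ratio nu y"
proof (rule DERIV_pos_imp_increasing[OF assms(3)])
  fix z assume "x \<le> z"
  with assms have "z > 0" by simp
  with DERIV_bessel_ratio[OF this] bessel_ratio_deriv_pos[OF assms(1) this]
  show "\<exists>w. (bessel_ratio nu has_real_derivative w) (at z) \<and> w > 0" by blast
qed

lemma bessel_ratio_strict_antimono:
  assumes "nu < 1/2" "0 < x" "x < y"
  shows "bessel_ratio nu y < bessel_ratio nu x"
proof (rule DERIV_neg_imp_decreasing[OF assms(3)])
  fix z assume "x \<le> z"
  with assms have "z > 0" by simp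
  with DERIV_bessel_ratio[OF this] bessel_ratio_deriv_neg[OF assms(1) this]
  show "\<exists>w. (bessel_ratio nu has_real_derivative w) (at z) \<and> w < 0" by blast
qed

lemma bessel_ratio_mono:
  assumes "nu \<ge> 1/2" "0 < x" "x \<le> y"
  shows "bessel_ratio nu x \<le> bessel_ratio nu y"
proof (cases "nu = 1/2")
  case True
  show ?thesis unfolding True using bessel_ratio_half[of x] bessel_ratio_half[of y] assms by simp
next
  case False
  then show ?thesis using bessel_ratio_strict_mono[of nu x y] assms by (cases "x = y") auto
qed

lemma bessel_ratio_antimono:
  assumes "nu \<le> 1/2" "0 < x" "x \<le> y"
  shows "bessel_ratio nu y \<le> bessel_ratio nu x"
proof (cases "nu = 1/2")
  case True
  show ?thesis unfolding True using bessel_ratio_half[of x] bessel_ratio_half[of y] assms by simp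
next
  case False
  then show ?thesis using bessel_ratio_strict_antimono[of nu x y] assms by (cases "x = y") auto
qed

lemma bessel_ratio_ge_1:
  assumes "nu \<le> 1/2" "z > 0"
  shows "bessel_ratio nu z \<ge> 1"
proof (rule tendsto_upperbound[OF tendsto_bessel_ratio[of nu]])
  show "\<forall>\<^sub>F y in at_top. bessel_ratio nu y \<le> bessel_ratio nu z"
    using eventually_ge_at_top[of z] by eventually_elim (rule bessel_ratio_antimono[OF assms])
qed auto

text \<open>If the ratio stayed above \<open>L\<close>, the Riccati equation would give a derivative
  of at least \<open>(2 * nu - 1) * L / z - 1\<close>, whose integral diverges logarithmically at 0,
  against positivity of the ratio.\<close>

lemma bessel_ratio_small_near_0:
  assumes nu: "nu > 1/2" and "L > 0"
  shows "\<exists>z>0. bessel_ratio nu z < L"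
proof (rule ccontr)
  let ?p = "bessel_ratio nu" and ?c = "2 * nu - 1"
  assume "\<not> ?thesis"
  then have ge: "?p z \<ge> L" if "z > 0" for z using that by (meson not_less)
  \<comment> \<open>Chosen so that \<open>?c * L * ln z = - (?p 1 + 1)\<close>, which turns the
    comparison with the point 1 into \<open>?p z + z \<le> 0\<close>.\<close>
  define z where "z = exp (- (?p 1 + 1) / (?c * L))"
  have cL: "?c * L > 0" using assms by simp
  have z: "0 < z" "z < 1"
    using cL bessel_ratio_pos[of 1 nu] by (auto simp: z_def divide_neg_pos)
  have "?p z + z - ?c * L * ln z \<le> ?p 1 + 1 - ?c * L * ln 1"
  proof (rule DERIV_nonneg_imp_nondecreasing[where f = "\<lambda>z. ?p z + z - ?c * L * ln z"])
    fix y assume "z \<le> y" "y \<le> 1"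
    then have y: "y > 0" using z by simp
    have "((\<lambda>z. ?p z + z - ?c * L * ln z) has_real_derivative
        ((?p y)\<^sup>2 - 1 + ?c * ?p y / y) + 1 - ?c * L * (1 / y)) (at y)"
      using y by (intro DERIV_diff DERIV_add DERIV_bessel_ratio DERIV_ident DERIV_cmult DERIV_ln_divide)
    moreover have "0 \<le> ?c * (?p y - L) / y"
      using ge[OF y] y nu by simp
    then have "0 \<le> ((?p y)\<^sup>2 - 1 + ?c * ?p y / y) + 1 - ?c * L * (1 / y)"
      by (simp add: diff_divide_distrib right_diff_distrib add_increasing)
    ultimately show "\<exists>w. ((\<lambda>z. ?p z + z - ?c * L * ln z) has_real_derivative w) (at y) \<and> 0 \<le> w"
      by blast
  qed (use z in simp)
  moreover have "?c * L * ln z = - (?p 1 + 1)"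
    unfolding z_def using cL nu \<open>L > 0\<close> by simp
  ultimately show False using bessel_ratio_pos[OF z(1), of nu] z(1) by simp
qed

section \<open>The logarithmic slope of the symmetric part\<close>

definition bessel_slope :: "real \<Rightarrow> real \<Rightarrow> real \<Rightarrow> real \<Rightarrow> real" where
  "bessel_slope nu \<alpha> \<delta> y =
     y / sqrt (\<delta>\<^sup>2 + y\<^sup>2) * bessel_ratio nu (\<alpha> * sqrt (\<delta>\<^sup>2 + y\<^sup>2))"

text \<open>The right-hand side of the Riccati equation of \<open>bessel_slope\<close>, cleared of
  the denominator \<open>\<delta>\<^sup>2 + y\<^sup>2\<close>; it has the sign of the
  derivative.\<close>

definition slope_ode :: "real \<Rightarrow> real \<Rightarrow> real \<Rightarrow> real \<Rightarrow> real \<Rightarrow> real" where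
  "slope_ode nu \<alpha> \<delta> y p = \<alpha> * ((\<delta>\<^sup>2 + y\<^sup>2) * p\<^sup>2 - y\<^sup>2) + p * (\<delta>\<^sup>2 / y + (2 * nu - 1) * y)"

lemma radius_pos: "y > 0 \<Longrightarrow> \<delta>\<^sup>2 + y\<^sup>2 > (0::real)"
  by (simp add: add_nonneg_pos)

lemma DERIV_radius:
  assumes "\<delta>\<^sup>2 + y\<^sup>2 > (0::real)"
  shows "((\<lambda>y. sqrt (\<delta>\<^sup>2 + y\<^sup>2)) has_real_derivative y / sqrt (\<delta>\<^sup>2 + y\<^sup>2)) (at y)"
  using assms by (auto intro!: derivative_eq_intros simp: field_simps)

lemma filterlim_radius: "filterlim (\<lambda>y. sqrt (\<delta>\<^sup>2 + y\<^sup>2)) at_top (at_top :: real filter)"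
proof (rule filterlim_at_top_mono[OF filterlim_ident])
  have "y \<le> sqrt (\<delta>\<^sup>2 + y\<^sup>2)" if "y \<ge> 0" for y :: real
    by (rule real_le_rsqrt) simp
  then show "\<forall>\<^sub>F y in at_top. y \<le> sqrt (\<delta>\<^sup>2 + y\<^sup>2)"
    using eventually_ge_at_top[of 0] by (auto elim: eventually_mono)
qed

context
  fixes \<alpha> :: real
  assumes \<alpha>: "\<alpha> > 0"
begin

lemma bessel_slope_pos: "y > 0 \<Longrightarrow> bessel_slope nu \<alpha> \<delta> y > 0"
  using \<alpha> radius_pos[of y \<delta>] by (simp add: bessel_slope_def bessel_ratio_pos)

lemma bessel_slope_0: "y > 0 \<Longrightarrow> bessel_slope nu \<alpha> 0 y = bessel_ratio nu (\<alpha> * y)"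
  by (simp add: bessel_slope_def)

lemma DERIV_bessel_slope:
  assumes y: "y > 0"
  shows "(bessel_slope nu \<alpha> \<delta> has_real_derivative
    slope_ode nu \<alpha> \<delta> y (bessel_slope nu \<alpha> \<delta> y) / (\<delta>\<^sup>2 + y\<^sup>2)) (at y)"
proof -
  define r p where "r = sqrt (\<delta>\<^sup>2 + y\<^sup>2)" and "p = bessel_ratio nu (\<alpha> * r)"
  have r2: "\<delta>\<^sup>2 + y\<^sup>2 = r\<^sup>2" and r: "r > 0"
    using radius_pos[OF y, of \<delta>] by (auto simp: r_def)
  have dr: "((\<lambda>y. sqrt (\<delta>\<^sup>2 + y\<^sup>2)) has_real_derivative y / r) (at y)"
    unfolding r_def by (rule DERIV_radius[OF radius_pos[OF y]])
  have "((\<lambda>y. bessel_ratio nu (\<alpha> * sqrt (\<delta>\<^sup>2 + y\<^sup>2))) has_real_derivative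
      (p\<^sup>2 - 1 + (2 * nu - 1) * p / (\<alpha> * r)) * (\<alpha> * (y / r))) (at y)"
    unfolding p_def using \<alpha> r
    by (intro DERIV_chain2[where f = "bessel_ratio nu" and g = "\<lambda>y. \<alpha> * sqrt (\<delta>\<^sup>2 + y\<^sup>2)"] DERIV_cmult dr)
      (simp add: DERIV_bessel_ratio flip: r_def)
  from DERIV_mult[OF DERIV_divide[OF DERIV_ident dr] this]
  have "(bessel_slope nu \<alpha> \<delta> has_real_derivative
     (r - y * (y / r)) / (r * r) * p + (p\<^sup>2 - 1 + (2 * nu - 1) * p / (\<alpha> * r)) * (\<alpha> * (y / r)) * (y / r)) (at y)"
    unfolding bessel_slope_def[abs_def] using r by (simp flip: r_def p_def)
  moreover have "(r - y * (y / r)) / (r * r) * p + (p\<^sup>2 - 1 + (2 * nu - 1) * p / (\<alpha> * r)) * (\<alpha> * (y / r)) * (y / r)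
    = slope_ode nu \<alpha> \<delta> y (bessel_slope nu \<alpha> \<delta> y) / (\<delta>\<^sup>2 + y\<^sup>2)"
  proof -
    have d: "\<delta>\<^sup>2 = r\<^sup>2 - y\<^sup>2" using r2 by simp
    have P: "bessel_slope nu \<alpha> \<delta> y = y / r * p" by (simp add: bessel_slope_def r_def p_def)
    show ?thesis
      unfolding slope_ode_def P r2 unfolding d using r y \<alpha>
      by (simp add: field_simps power2_eq_square)
  qed
  ultimately show ?thesis by (simp only:)
qed

lemma tendsto_bessel_slope: "(bessel_slope nu \<alpha> \<delta> \<longlongrightarrow> 1) at_top"
proof -
  have "filterlim (\<lambda>y. \<alpha> * sqrt (\<delta>\<^sup>2 + y\<^sup>2)) at_top at_top"
    by (rule filterlim_tendsto_pos_mult_at_top[OF tendsto_const \<alpha> filterlim_radius])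
  note ratio = filterlim_compose[OF tendsto_bessel_ratio this]
  \<comment> \<open>With \<open>r\<close> the radius, \<open>y / r\<close> is written as
    \<open>sqrt (1 - \<delta>\<^sup>2 / r\<^sup>2)\<close>, so its limit follows from
    \<open>r\<close> tending to infinity.\<close>
  have "((\<lambda>y. sqrt (1 - \<delta>\<^sup>2 * inverse ((sqrt (\<delta>\<^sup>2 + y\<^sup>2))\<^sup>2))) \<longlongrightarrow> sqrt (1 - \<delta>\<^sup>2 * 0)) at_top"
    by (intro tendsto_intros tendsto_inverse_0_at_top filterlim_pow_at_top filterlim_radius) simp
  moreover have "\<forall>\<^sub>F y in at_top. sqrt (1 - \<delta>\<^sup>2 * inverse ((sqrt (\<delta>\<^sup>2 + y\<^sup>2))\<^sup>2)) = y / sqrt (\<delta>\<^sup>2 + y\<^sup>2)"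
    using eventually_gt_at_top[of 0]
  proof eventually_elim
    case (elim y)
    have "1 - \<delta>\<^sup>2 * inverse ((sqrt (\<delta>\<^sup>2 + y\<^sup>2))\<^sup>2) = y\<^sup>2 / (\<delta>\<^sup>2 + y\<^sup>2)"
      using radius_pos[OF elim, of \<delta>] elim by (simp add: inverse_eq_divide eq_divide_eq left_diff_distrib)
    then show ?case using elim by (simp add: real_sqrt_divide)
  qed
  ultimately have "((\<lambda>y. y / sqrt (\<delta>\<^sup>2 + y\<^sup>2)) \<longlongrightarrow> 1) at_top"
    by (simp add: filterlim_cong)
  from tendsto_mult[OF this ratio] show ?thesis by (simp add: bessel_slope_def[abs_def])
qed

text \<open>Both factors are nonnegative and nondecreasing:
  \<open>y / sqrt (\<delta>\<^sup>2 + y\<^sup>2)\<close> for every order, the ratio because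
  \<open>nu \<ge> 1/2\<close>.\<close>

lemma bessel_slope_mono:
  assumes "nu \<ge> 1/2" "0 < x" "x \<le> y"
  shows "bessel_slope nu \<alpha> \<delta> x \<le> bessel_slope nu \<alpha> \<delta> y"
  unfolding bessel_slope_def
proof (rule mult_mono)
  have le: "sqrt (\<delta>\<^sup>2 + x\<^sup>2) \<le> sqrt (\<delta>\<^sup>2 + y\<^sup>2)" using assms by simp
  have "\<delta>\<^sup>2 + x\<^sup>2 > 0" "\<delta>\<^sup>2 + y\<^sup>2 > 0" using assms by (auto intro: radius_pos)
  then show "bessel_ratio nu (\<alpha> * sqrt (\<delta>\<^sup>2 + x\<^sup>2)) \<le> bessel_ratio nu (\<alpha> * sqrt (\<delta>\<^sup>2 + y\<^sup>2))"
    and "0 \<le> bessel_ratio nu (\<alpha> * sqrt (\<delta>\<^sup>2 + x\<^sup>2))"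
    using \<alpha> le assms by (auto intro!: bessel_ratio_mono less_imp_le[OF bessel_ratio_pos])
  show "x / sqrt (\<delta>\<^sup>2 + x\<^sup>2) \<le> y / sqrt (\<delta>\<^sup>2 + y\<^sup>2)"
  proof (rule power2_le_imp_le)
    have "x\<^sup>2 \<le> y\<^sup>2" using assms by simp
    then have "x\<^sup>2 * (\<delta>\<^sup>2 + y\<^sup>2) \<le> y\<^sup>2 * (\<delta>\<^sup>2 + x\<^sup>2)"
      using mult_right_mono[of "x\<^sup>2" "y\<^sup>2" "\<delta>\<^sup>2"] by (simp add: algebra_simps)
    then show "(x / sqrt (\<delta>\<^sup>2 + x\<^sup>2))\<^sup>2 \<le> (y / sqrt (\<delta>\<^sup>2 + y\<^sup>2))\<^sup>2"
      using \<open>\<delta>\<^sup>2 + x\<^sup>2 > 0\<close> \<open>\<delta>\<^sup>2 + y\<^sup>2 > 0\<close> by (simp add: power_divide divide_simps mult_ac)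
  qed (use assms in simp)
  show "0 \<le> y / sqrt (\<delta>\<^sup>2 + y\<^sup>2)" using assms by simp
qed

text \<open>Since the radius stays positive at the centre, the ratio has a finite limit there while
  the factor in front of it vanishes.\<close>

lemma tendsto_bessel_slope_0:
  assumes "\<delta> \<noteq> 0"
  shows "(bessel_slope nu \<alpha> \<delta> \<longlongrightarrow> 0) (at_right 0)"
proof -
  have "\<alpha> * sqrt (\<delta>\<^sup>2 + 0\<^sup>2) > 0" using \<alpha> assms by simp
  from DERIV_isCont[OF DERIV_bessel_ratio[OF this]]
  have "((\<lambda>y. bessel_ratio nu (\<alpha> * sqrt (\<delta>\<^sup>2 + y\<^sup>2))) \<longlongrightarrow> bessel_ratio nu (\<alpha> * sqrt (\<delta>\<^sup>2 + 0\<^sup>2))) (at_right 0)"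
    by (rule isCont_tendsto_compose) (intro tendsto_intros)
  moreover have "((\<lambda>y. y / sqrt (\<delta>\<^sup>2 + y\<^sup>2)) \<longlongrightarrow> 0 / sqrt (\<delta>\<^sup>2 + 0\<^sup>2)) (at_right 0)"
    using assms by (intro tendsto_intros) simp
  ultimately have "((\<lambda>y. y / sqrt (\<delta>\<^sup>2 + y\<^sup>2) * bessel_ratio nu (\<alpha> * sqrt (\<delta>\<^sup>2 + y\<^sup>2)))
      \<longlongrightarrow> 0 / sqrt (\<delta>\<^sup>2 + 0\<^sup>2) * bessel_ratio nu (\<alpha> * sqrt (\<delta>\<^sup>2 + 0\<^sup>2))) (at_right 0)"
    by (intro tendsto_mult)
  then show ?thesis by (simp add: bessel_slope_def[abs_def])
qed

text \<open>Where the slope is at most its limit 1, its critical points can only be strict local maxima;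
  so a slope that decreases there would decrease forever and miss the limit.\<close>

lemma slope_ode_pos:
  assumes nu: "nu \<le> 1/2" and \<delta>: "\<delta> \<noteq> 0" and "y > 0" and le1: "bessel_slope nu \<alpha> \<delta> y \<le> 1"
  shows "slope_ode nu \<alpha> \<delta> y (bessel_slope nu \<alpha> \<delta> y) > 0"
proof (rule ccontr)
  let ?P = "bessel_slope nu \<alpha> \<delta>" and ?c = "2 * nu - 1"
  define D where "D = (\<lambda>y. slope_ode nu \<alpha> \<delta> y (?P y))"
  define P' where "P' = (\<lambda>y. D y / (\<delta>\<^sup>2 + y\<^sup>2))"
  define D' where "D' = (\<lambda>y. \<alpha> * (2 * y * (?P y)\<^sup>2 + (\<delta>\<^sup>2 + y\<^sup>2) * (2 * ?P y * P' y) - 2 * y)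
     + (P' y * (\<delta>\<^sup>2 / y + ?c * y) + ?P y * (?c - \<delta>\<^sup>2 / y\<^sup>2)))"
  have dP: "(?P has_real_derivative P' t) (at t)" if "t > 0" for t
    using DERIV_bessel_slope[OF that] by (simp add: P'_def D_def)
  have dD: "(D has_real_derivative D' t) (at t)" if "t > 0" for t
    unfolding D_def slope_ode_def using that
    by (auto intro!: derivative_eq_intros dP simp: D'_def power2_eq_square field_simps)
  assume "\<not> ?thesis"
  then have "D y \<le> 0" by (simp add: D_def)
  \<comment> \<open>As long as \<open>D\<close> is nonpositive the slope cannot rise, so the bound
    by 1 is carried along from \<open>y\<close>.\<close>
  have dec: "?P t \<le> ?P y" if "y \<le> t" "\<And>s. y \<le> s \<Longrightarrow> s \<le> t \<Longrightarrow> D s \<le> 0" for t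
  proof (rule DERIV_nonpos_imp_nonincreasing[OF that(1)])
    fix s assume "y \<le> s" "s \<le> t"
    then show "\<exists>w. (?P has_real_derivative w) (at s) \<and> w \<le> 0"
      using dP[of s] \<open>y > 0\<close> that(2)[of s] radius_pos[of s \<delta>]
      by (intro exI[of _ "P' s"]) (auto simp: P'_def divide_nonpos_pos)
  qed
  have neg: "D t < 0" if "t > y" for t
  proof (rule stays_negative[OF dD \<open>D y \<le> 0\<close> _ that])
    fix t assume t: "y \<le> t" "D t = 0" "\<And>s. y \<le> s \<Longrightarrow> s \<le> t \<Longrightarrow> D s \<le> 0"
    then have "?P t \<le> 1" using dec[of t] le1 by simp
    have "t > 0" using t \<open>y > 0\<close> by simp
    have "?P t > 0" by (rule bessel_slope_pos[OF \<open>t > 0\<close>])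
    have "\<alpha> * (2 * t * ((?P t)\<^sup>2 - 1)) \<le> 0"
      using \<alpha> \<open>t > 0\<close> \<open>?P t \<le> 1\<close> \<open>?P t > 0\<close> power_le_one[of "?P t" 2]
      by (intro mult_nonneg_nonpos) auto
    moreover have "?P t * (?c - \<delta>\<^sup>2 / t\<^sup>2) < 0"
    proof (rule mult_pos_neg[OF \<open>?P t > 0\<close>])
      have "\<delta>\<^sup>2 / t\<^sup>2 > 0" using \<open>t > 0\<close> \<delta> by simp
      then show "?c - \<delta>\<^sup>2 / t\<^sup>2 < 0" using nu by linarith
    qed
    \<comment> \<open>At a zero of \<open>D\<close> the terms containing \<open>P'\<close> drop out.
      Of the two that remain, the first is controlled by \<open>?P t \<le> 1\<close>, the second by
      \<open>nu \<le> 1/2\<close> and \<open>\<delta> \<noteq> 0\<close>.\<close>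
    moreover have "D' t = \<alpha> * (2 * t * ((?P t)\<^sup>2 - 1)) + ?P t * (?c - \<delta>\<^sup>2 / t\<^sup>2)"
      using t(2) by (simp add: D'_def P'_def algebra_simps)
    ultimately show "D' t < 0" by linarith
  qed (use \<open>y > 0\<close> in auto)
  have "?P (y + 1) > 1"
  proof (rule decreasing_gt_limit[OF dP _ tendsto_bessel_slope])
    fix t assume "t \<ge> y + 1"
    then show "P' t < 0" using neg[of t] \<open>y > 0\<close> radius_pos[of t \<delta>] by (simp add: P'_def divide_neg_pos)
  qed (use \<open>y > 0\<close> in auto)
  moreover have "?P (y + 1) \<le> ?P y"
  proof (rule dec)
    fix s assume "y \<le> s"
    then show "D s \<le> 0" using neg[of s] \<open>D y \<le> 0\<close> by (cases "s = y") auto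
  qed simp
  ultimately show False using le1 by simp
qed

text \<open>If the slope stayed at most 1, the quadratic part of \<open>slope_ode\<close> would be
  bounded above while its term \<open>(2 * nu - 1) * y * p\<close> tends to minus infinity,
  contradicting \<open>slope_ode_pos\<close>.\<close>

lemma bessel_slope_exceeds_1:
  assumes nu: "nu < 1/2" and \<delta>: "\<delta> \<noteq> 0"
  shows "\<exists>y>0. bessel_slope nu \<alpha> \<delta> y > 1"
proof (rule ccontr)
  let ?P = "bessel_slope nu \<alpha> \<delta>"
  define c where "c = 1 - 2 * nu"
  have c: "c > 0" using nu by (simp add: c_def)
  assume "\<not> ?thesis"
  then have le1: "?P y \<le> 1" if "y > 0" for y using that by (meson not_less)
  have "\<forall>\<^sub>F y in at_top. ?P y > 1/2"
    by (rule order_tendstoD(1)[OF tendsto_bessel_slope]) simp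
  \<comment> \<open>\<open>y \<ge> 1\<close> bounds \<open>\<delta>\<^sup>2 / y\<close>; the other
    threshold leaves a coefficient of at most \<open>- (2 * \<alpha> * \<delta>\<^sup>2)\<close>,
    which offsets the quadratic part even when multiplied by a slope of only 1/2.\<close>
  moreover have "\<forall>\<^sub>F y in at_top. y \<ge> max 1 ((\<delta>\<^sup>2 + 2 * \<alpha> * \<delta>\<^sup>2) / c)" by (rule eventually_ge_at_top)
  ultimately have "\<forall>\<^sub>F y in at_top. ?P y > 1/2 \<and> y \<ge> max 1 ((\<delta>\<^sup>2 + 2 * \<alpha> * \<delta>\<^sup>2) / c)"
    by eventually_elim simp
  then obtain y where y: "?P y > 1/2" "y \<ge> 1" "y \<ge> (\<delta>\<^sup>2 + 2 * \<alpha> * \<delta>\<^sup>2) / c"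
    by (auto simp: eventually_at_top_linorder)
  have "(?P y)\<^sup>2 \<le> 1" using y le1[of y] by (intro power_le_one) auto
  then have "\<alpha> * ((\<delta>\<^sup>2 + y\<^sup>2) * (?P y)\<^sup>2 - y\<^sup>2) \<le> \<alpha> * \<delta>\<^sup>2"
    using \<alpha> mult_left_mono[of "(?P y)\<^sup>2" 1 "\<delta>\<^sup>2 + y\<^sup>2"] by simp
  moreover have "\<delta>\<^sup>2 / y \<le> \<delta>\<^sup>2" using y(2) mult_left_mono[of 1 y "\<delta>\<^sup>2"] by (simp add: divide_simps)
  then have "\<delta>\<^sup>2 / y + (2 * nu - 1) * y \<le> - (2 * \<alpha> * \<delta>\<^sup>2)"
    using y(3) c by (simp add: c_def field_simps)
  then have "?P y * (\<delta>\<^sup>2 / y + (2 * nu - 1) * y) \<le> ?P y * - (2 * \<alpha> * \<delta>\<^sup>2)"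
    using y(1) by (intro mult_left_mono) auto
  moreover have "?P y * - (2 * \<alpha> * \<delta>\<^sup>2) \<le> 1/2 * - (2 * \<alpha> * \<delta>\<^sup>2)"
    using y(1) \<alpha> by (intro mult_right_mono_neg) auto
  ultimately have "slope_ode nu \<alpha> \<delta> y (?P y) \<le> 0" by (simp add: slope_ode_def)
  moreover have "slope_ode nu \<alpha> \<delta> y (?P y) > 0"
    using y nu \<delta> le1[of y] by (intro slope_ode_pos) auto
  ultimately show False by simp
qed

lemma bessel_slope_stays_above:
  assumes nu: "nu \<ge> 1/2 \<or> \<delta> \<noteq> 0" and "b \<le> 1" and "0 < x" "x \<le> y" and above: "b \<le> bessel_slope nu \<alpha> \<delta> x"
  shows "b \<le> bessel_slope nu \<alpha> \<delta> y"
proof (cases "nu \<ge> 1/2")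
  case True
  then show ?thesis using bessel_slope_mono[of nu x y \<delta>] assms by simp
next
  let ?P = "bessel_slope nu \<alpha> \<delta>"
  case False
  have cont: "continuous_on {x..y} ?P"
    using \<open>0 < x\<close> by (intro continuous_at_imp_continuous_on ballI DERIV_isCont[OF DERIV_bessel_slope]) auto
  show ?thesis
  proof (rule ccontr)
    assume not: "\<not> b \<le> ?P y"
    \<comment> \<open>The greatest element \<open>t\<close> of \<open>S\<close> is the last point up
      to \<open>y\<close> where the slope is at least \<open>b\<close>; beyond it the slope lies
      under \<open>b\<close> and hence increases.\<close>
    define S where "S = {x..y} \<inter> ?P -` {b..}"
    have "compact S"
      unfolding S_def compact_eq_bounded_closed using cont
      by (auto intro!: continuous_closed_preimage bounded_Int)
    moreover have "x \<in> S" using above \<open>x \<le> y\<close> by (simp add: S_def)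
    ultimately obtain t where t: "t \<in> S" "\<And>s. s \<in> S \<Longrightarrow> s \<le> t"
      using compact_attains_sup[of S] by auto
    then have "x \<le> t" "t \<noteq> y" "t \<le> y" "b \<le> ?P t" using not by (auto simp: S_def)
    have "?P t < ?P y"
    proof (rule DERIV_pos_imp_increasing_open[where f = ?P])
      show "t < y" using \<open>t \<noteq> y\<close> \<open>t \<le> y\<close> by simp
      fix s assume s: "t < s" "s < y"
      then have "s \<notin> S" using t(2)[of s] by auto
      then have "?P s \<le> 1" using s \<open>x \<le> t\<close> \<open>b \<le> 1\<close> by (auto simp: S_def)
      moreover have "s > 0" using s \<open>x \<le> t\<close> \<open>0 < x\<close> by simp
      ultimately show "\<exists>w. (?P has_real_derivative w) (at s) \<and> 0 < w"
        using DERIV_bessel_slope[of s nu \<delta>] slope_ode_pos[of nu \<delta> s] False nu radius_pos[of s \<delta>]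
        by (intro exI[of _ "slope_ode nu \<alpha> \<delta> s (?P s) / (\<delta>\<^sup>2 + s\<^sup>2)"]) auto
    next
      show "continuous_on {t..y} ?P"
        using continuous_on_subset[OF cont] \<open>x \<le> t\<close> by auto
    qed
    then show False using \<open>b \<le> ?P t\<close> not by simp
  qed
qed

end

lemma crossing_point:
  fixes P :: "real \<Rightarrow> real"
  assumes stays: "\<And>x y. 0 < x \<Longrightarrow> x \<le> y \<Longrightarrow> b \<le> P x \<Longrightarrow> b \<le> P y"
    and "x0 > 0" "b \<le> P x0"
  shows "\<exists>x\<ge>0. (\<forall>r. 0 < r \<longrightarrow> r < x \<longrightarrow> P r \<le> b) \<and> (\<forall>r>x. b \<le> P r)"
proof -
  \<comment> \<open>Inserting 0 makes the supremum nonnegative and gives the crossing point 0 when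
    the level is never undercut.\<close>
  define S where "S = insert 0 {y. 0 < y \<and> P y < b}"
  have "bdd_above S"
  proof (rule bdd_aboveI)
    fix y assume "y \<in> S"
    then show "y \<le> x0"
      using stays[OF assms(2) _ assms(3), of y] \<open>x0 > 0\<close> by (cases "y \<le> x0") (auto simp: S_def)
  qed
  have "Sup S \<ge> 0" using \<open>bdd_above S\<close> by (intro cSup_upper) (auto simp: S_def)
  moreover have "P r \<le> b" if r: "0 < r" "r < Sup S" for r
  proof -
    have "S \<noteq> {}" by (simp add: S_def)
    then obtain y where "y \<in> S" "r < y" using less_cSupD[of S r] r(2) by blast
    with r(1) stays[of r y] show ?thesis by (force simp: S_def)
  qed
  moreover have "b \<le> P r" if "Sup S < r" for r
    using cSup_upper[OF _ \<open>bdd_above S\<close>, of r] that \<open>Sup S \<ge> 0\<close> by (force simp: S_def)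
  ultimately show ?thesis by blast
qed

section \<open>Exponentially tilted symmetric densities\<close>

text \<open>Adding the tangent inequalities at \<open>x\<close> and at \<open>y\<close> leaves
  \<open>(g' x - g' y) * (y - x) \<le> 0\<close>.\<close>

lemma convex_on_imp_deriv_mono:
  fixes g g' :: "real \<Rightarrow> real"
  assumes "convex_on A g" "open A" "\<And>x. x \<in> A \<Longrightarrow> (g has_real_derivative g' x) (at x)"
    and "x \<in> A" "y \<in> A" "x \<le> y"
  shows "g' x \<le> g' y"
proof (cases "x = y")
  case False
  have conn: "connected A"
    using convex_on_imp_convex[OF assms(1)] by (rule convex_connected)
  have tangent: "g' a * (b - a) \<le> g b - g a" if "a \<in> A" "b \<in> A" for a b
    using convex_on_imp_above_tangent[OF assms(1) conn _ that(2), of a "g' a"] assms(2) that(1)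
      has_field_derivative_at_within[OF assms(3)[OF that(1)]]
    by (auto simp: interior_open)
  have "(g' x - g' y) * (y - x) \<le> 0"
    using tangent[of x y] tangent[of y x] assms(4,5) by (simp add: algebra_simps)
  then show ?thesis using False \<open>x \<le> y\<close> by (simp add: mult_le_0_iff)
qed simp

lemma convex_on_cong_fun:
  assumes "\<And>x. x \<in> A \<Longrightarrow> f x = g x"
  shows "convex_on A f \<longleftrightarrow> convex_on A g"
  using assms by (auto simp: convex_on_def convexD)

lemma ennreal_power_exp: "ennreal_power (ennreal (exp a)) p = ennreal (exp (p * a))"
  by (simp add: ennreal_power_def exp_powr_real mult.commute)

text \<open>Reflection exchanges the two monotone branches; it will transfer results for
  \<open>\<beta> \<ge> 0\<close> to negative tilts.\<close>

lemma is_mode_reflect: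
  assumes "is_mode (\<lambda>y. f (2 * m - y)) (2 * m - x)"
  shows "is_mode f x"
proof -
  have "f r \<le> f s" if "r \<le> s" "s \<le> x" for r s
    using monotone_onD[of "{2 * m - x..}" "(\<le>)" "(\<ge>)" "\<lambda>y. f (2 * m - y)" "2 * m - s" "2 * m - r"] assms that
    by (auto simp: is_mode_def)
  moreover have "f s \<le> f r" if "r \<le> s" "x \<le> r" for r s
    using mono_onD[of "{..2 * m - x}" "\<lambda>y. f (2 * m - y)" "2 * m - s" "2 * m - r"] assms that
    by (auto simp: is_mode_def)
  ultimately show ?thesis
    by (auto simp: is_mode_def intro!: mono_onI monotone_onI)
qed

text \<open>At distance \<open>r\<close> from \<open>\<mu>\<close> the logarithm of the density is
  \<open>H r\<close> plus or minus \<open>\<beta> * r\<close>, and \<open>Q\<close> is the decay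
  rate of \<open>H\<close>. The Bessel case and the power case \<open>\<alpha> = 0\<close> share
  this shape. The centre enters only as a limit, which may be infinite.\<close>

locale tilted_even_density =
  fixes f :: "real \<Rightarrow> ennreal" and \<mu> \<beta> :: real and H Q :: "real \<Rightarrow> real"
  assumes off: "\<And>y. y \<noteq> \<mu> \<Longrightarrow> f y = ennreal (exp (\<beta> * (y - \<mu>) + H \<bar>y - \<mu>\<bar>))"
    and lim: "(f \<longlongrightarrow> f \<mu>) (at \<mu>)"
    and DERIV_H: "\<And>r. r > 0 \<Longrightarrow> (H has_real_derivative - Q r) (at r)"
    and Q_pos: "\<And>r. r > 0 \<Longrightarrow> Q r > 0"
begin

lemma reflect: "tilted_even_density (\<lambda>y. f (2 * \<mu> - y)) \<mu> (- \<beta>) H Q"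
proof
  fix y assume "y \<noteq> \<mu>"
  then show "f (2 * \<mu> - y) = ennreal (exp (- \<beta> * (y - \<mu>) + H \<bar>y - \<mu>\<bar>))"
    using off[of "2 * \<mu> - y"] by (simp add: algebra_simps abs_minus_commute)
next
  have "filterlim (\<lambda>y. 2 * \<mu> - y) (at \<mu>) (at \<mu>)"
    by (rule filterlim_atI) (auto intro!: tendsto_eq_intros simp: eventually_at_filter)
  from filterlim_compose[OF lim this]
  show "((\<lambda>y. f (2 * \<mu> - y)) \<longlongrightarrow> f (2 * \<mu> - \<mu>)) (at \<mu>)" by simp
qed (use DERIV_H Q_pos in auto)

lemma DERIV_tilted: "r > 0 \<Longrightarrow> ((\<lambda>r. b * r + H r) has_real_derivative b - Q r) (at r)"
  by (auto intro!: derivative_eq_intros DERIV_H)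

lemma tilted_mono:
  assumes "0 < s" "s \<le> t" "\<And>r. s < r \<Longrightarrow> r < t \<Longrightarrow> Q r \<le> b"
  shows "b * s + H s \<le> b * t + H t"
proof (rule DERIV_nonneg_imp_increasing_open[OF assms(2), where f = "\<lambda>r. b * r + H r"])
  fix r assume "s < r" "r < t"
  then show "\<exists>y. ((\<lambda>r. b * r + H r) has_real_derivative y) (at r) \<and> 0 \<le> y"
    using assms DERIV_tilted[of r b] by (intro exI[of _ "b - Q r"]) auto
next
  show "continuous_on {s..t} (\<lambda>r. b * r + H r)"
    using assms by (intro continuous_at_imp_continuous_on ballI DERIV_isCont[OF DERIV_tilted]) auto
qed

lemma tilted_antimono:
  assumes "0 < s" "s \<le> t" "\<And>r. s < r \<Longrightarrow> r < t \<Longrightarrow> b \<le> Q r"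
  shows "b * t + H t \<le> b * s + H s"
proof (rule DERIV_nonpos_imp_decreasing_open[OF assms(2), where f = "\<lambda>r. b * r + H r"])
  fix r assume "s < r" "r < t"
  then show "\<exists>y. ((\<lambda>r. b * r + H r) has_real_derivative y) (at r) \<and> y \<le> 0"
    using assms DERIV_tilted[of r b] by (intro exI[of _ "b - Q r"]) auto
next
  show "continuous_on {s..t} (\<lambda>r. b * r + H r)"
    using assms by (intro continuous_at_imp_continuous_on ballI DERIV_isCont[OF DERIV_tilted]) auto
qed

lemma H_antimono:
  assumes "0 < s" "s \<le> t"
  shows "H t \<le> H s"
proof -
  have "0 * t + H t \<le> 0 * s + H s"
  proof (rule tilted_antimono[OF assms])
    show "0 \<le> Q r" if "s < r" for r using Q_pos[of r] that assms by simp
  qed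
  then show ?thesis by simp
qed

lemma off_right: "y > \<mu> \<Longrightarrow> f y = ennreal (exp (\<beta> * (y - \<mu>) + H (y - \<mu>)))"
  using off[of y] by simp

lemma off_left: "y < \<mu> \<Longrightarrow> f y = ennreal (exp (- \<beta> * (\<mu> - y) + H (\<mu> - y)))"
  using off[of y] by (simp add: algebra_simps)

section \<open>Location of the mode\<close>

text \<open>The outward logarithmic slope is \<open>- \<beta> - Q r\<close> on the left, always
  negative, and \<open>\<beta> - Q r\<close> on the right, nonnegative before distance
  \<open>x - \<mu>\<close> and nonpositive after it.\<close>

lemma is_mode_right:
  assumes "0 \<le> \<beta>" "\<mu> \<le> x"
    and below: "\<And>r. 0 < r \<Longrightarrow> r < x - \<mu> \<Longrightarrow> Q r \<le> \<beta>"
    and above: "\<And>r. x - \<mu> < r \<Longrightarrow> \<beta> \<le> Q r"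
  shows "is_mode f x"
proof -
  have lim_left: "(f \<longlongrightarrow> f \<mu>) (at_left \<mu>)" and lim_right: "(f \<longlongrightarrow> f \<mu>) (at_right \<mu>)"
    using lim by (auto simp: filterlim_at_split)
  have left: "f y \<le> f z" if "y \<le> z" "z < \<mu>" for y z
    using that off_left[of y] off_left[of z] tilted_antimono[of "\<mu> - z" "\<mu> - y" "- \<beta>"] \<open>0 \<le> \<beta>\<close> Q_pos
    by (smt (verit) ennreal_leI exp_le_cancel_iff)
  have mid: "f y \<le> f z" if "\<mu> < y" "y \<le> z" "z \<le> x" for y z
    using that off_right[of y] off_right[of z] tilted_mono[of "y - \<mu>" "z - \<mu>" \<beta>] below
    by (smt (verit) ennreal_leI exp_le_cancel_iff)
  have right: "f z \<le> f y" if "\<mu> < y" "y \<le> z" "x \<le> y" for y z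
    using that off_right[of y] off_right[of z] tilted_antimono[of "y - \<mu>" "z - \<mu>" \<beta>] above
    by (smt (verit) ennreal_leI exp_le_cancel_iff)
  \<comment> \<open>The branches meet at \<open>\<mu>\<close>, where \<open>f\<close> is known only
    as a limit; comparisons with \<open>f \<mu>\<close> come from passing to one-sided
    limits.\<close>
  have left': "f y \<le> f \<mu>" if "y < \<mu>" for y
  proof (rule tendsto_lowerbound[OF lim_left])
    show "\<forall>\<^sub>F z in at_left \<mu>. f y \<le> f z"
      using eventually_at_left_real[OF that] by eventually_elim (auto intro: left)
  qed auto
  have mid': "f \<mu> \<le> f y" if "\<mu> < y" "y \<le> x" for y
  proof (rule tendsto_upperbound[OF lim_right])
    show "\<forall>\<^sub>F z in at_right \<mu>. f z \<le> f y"
      using eventually_at_right_real[OF that(1)] by eventually_elim (use that in \<open>auto intro: mid\<close>)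
  qed auto
  have right': "f y \<le> f \<mu>" if "x = \<mu>" "\<mu> < y" for y
  proof (rule tendsto_lowerbound[OF lim_right])
    show "\<forall>\<^sub>F z in at_right \<mu>. f y \<le> f z"
      using eventually_at_right_real[OF that(2)] by eventually_elim (use that in \<open>auto intro: right\<close>)
  qed auto
  have "f y \<le> f z" if "y \<le> z" "z \<le> x" for y z
  proof -
    consider "z < \<mu>" | "z = \<mu>" "y < \<mu>" | "y = z" | "y < \<mu>" "\<mu> < z" | "y = \<mu>" "\<mu> < z" | "\<mu> < y"
      using \<open>y \<le> z\<close> by linarith
    then show ?thesis
      using that left[of y z] left'[of y] mid[of y z] mid'[of z] order_trans[of "f y" "f \<mu>" "f z"]
      by cases auto
  qed
  moreover have "f z \<le> f y" if yz: "y \<le> z" "x \<le> y" for y z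
  proof -
    consider "y = z" | "x = \<mu>" "y = \<mu>" "\<mu> < z" | "\<mu> < y"
      using yz \<open>\<mu> \<le> x\<close> by (smt (verit))
    then show ?thesis using yz right[of y z] right'[of z] by cases auto
  qed
  ultimately show ?thesis
    by (auto simp: is_mode_def intro!: mono_onI monotone_onI)
qed

text \<open>Monotonicity on the two sides of \<open>\<mu>\<close> forces both outward slopes,
  \<open>\<beta> - Q r\<close> and \<open>- \<beta> - Q r\<close>, to be nonpositive.\<close>

lemma is_mode_centre_imp:
  assumes mode: "is_mode f \<mu>" and r: "r > 0"
  shows "\<bar>\<beta>\<bar> \<le> Q r"
proof -
  have "mono_on {0<..} (\<lambda>r. - (\<beta> * r + H r))"
  proof (rule mono_onI)
    fix s t :: real assume "s \<in> {0<..}" "t \<in> {0<..}" "s \<le> t"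
    then have "f (\<mu> + t) \<le> f (\<mu> + s)"
      using mode monotone_onD[of "{\<mu>..}" "(\<le>)" "(\<ge>)" f "\<mu> + s" "\<mu> + t"] by (auto simp: is_mode_def)
    then show "- (\<beta> * s + H s) \<le> - (\<beta> * t + H t)"
      using off_right[of "\<mu> + s"] off_right[of "\<mu> + t"] \<open>s \<in> {0<..}\<close> \<open>t \<in> {0<..}\<close> by simp
  qed
  from mono_on_imp_deriv_nonneg[OF this DERIV_minus[OF DERIV_tilted[OF r]]]
  have "\<beta> \<le> Q r" using r by (simp add: interior_open)
  have "mono_on {0<..} (\<lambda>r. - (- \<beta> * r + H r))"
  proof (rule mono_onI)
    fix s t :: real assume "s \<in> {0<..}" "t \<in> {0<..}" "s \<le> t"
    then have "f (\<mu> - t) \<le> f (\<mu> - s)"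
      using mode monotone_onD[of "{..\<mu>}" "(\<le>)" "(\<le>)" f "\<mu> - t" "\<mu> - s"] by (auto simp: is_mode_def)
    then show "- (- \<beta> * s + H s) \<le> - (- \<beta> * t + H t)"
      using off_left[of "\<mu> - s"] off_left[of "\<mu> - t"] \<open>s \<in> {0<..}\<close> \<open>t \<in> {0<..}\<close> by simp
  qed
  from mono_on_imp_deriv_nonneg[OF this DERIV_minus[OF DERIV_tilted[OF r]]]
  have "- \<beta> \<le> Q r" using r by (simp add: interior_open)
  with \<open>\<beta> \<le> Q r\<close> show ?thesis by linarith
qed

lemma is_mode_centre_iff: "is_mode f \<mu> \<longleftrightarrow> (\<forall>r>0. \<bar>\<beta>\<bar> \<le> Q r)"
proof
  assume Q: "\<forall>r>0. \<bar>\<beta>\<bar> \<le> Q r"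
  interpret R: tilted_even_density "\<lambda>y. f (2 * \<mu> - y)" \<mu> "- \<beta>" H Q by (rule reflect)
  show "is_mode f \<mu>"
  proof (cases "\<beta> \<ge> 0")
    case True
    then show ?thesis using Q by (intro is_mode_right) auto
  next
    case False
    then show ?thesis using Q by (intro is_mode_reflect[of f \<mu>] R.is_mode_right) auto
  qed
qed (use is_mode_centre_imp in auto)

lemma unimodal_crossing:
  assumes "x \<ge> 0" "\<And>r. 0 < r \<Longrightarrow> r < x \<Longrightarrow> Q r \<le> \<bar>\<beta>\<bar>" "\<And>r. x < r \<Longrightarrow> \<bar>\<beta>\<bar> \<le> Q r"
  shows "unimodal f"
proof (cases "\<beta> \<ge> 0")
  case True
  then have "is_mode f (\<mu> + x)" using assms by (intro is_mode_right) auto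
  then show ?thesis by (auto simp: unimodal_def)
next
  interpret R: tilted_even_density "\<lambda>y. f (2 * \<mu> - y)" \<mu> "- \<beta>" H Q by (rule reflect)
  case False
  then have "is_mode (\<lambda>y. f (2 * \<mu> - y)) (2 * \<mu> - (\<mu> - x))" using assms by (intro R.is_mode_right) auto
  from is_mode_reflect[OF this] show ?thesis by (auto simp: unimodal_def)
qed

section \<open>Log-concavity and log-convexity\<close>

text \<open>On the right half-line the affine tilt drops out of the concavity inequality, so
  \<open>- H\<close> is convex there, with derivative \<open>Q\<close>.\<close>

lemma log_concave_imp_mono:
  assumes "log_concave_fun f" "0 < s" "s \<le> t"
  shows "Q s \<le> Q t"
proof (rule convex_on_imp_deriv_mono[where x = s and y = t and g' = Q and g = "\<lambda>r. - H r" and A = "{0<..}"])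
  show "convex_on {0<..} (\<lambda>r. - H r)"
  proof (rule convex_onI)
    fix u x y :: real assume u: "0 < u" "u < 1" and "x \<in> {0<..}" "y \<in> {0<..}"
    then have xy: "x > 0" "y > 0" by auto
    then have p: "(1 - u) * x + u * y > 0" using u by (simp add: add_pos_pos)
    have eq: "(1 - u) * (\<mu> + x) + (1 - (1 - u)) * (\<mu> + y) = \<mu> + ((1 - u) * x + u * y)"
      by (simp add: algebra_simps)
    have "1 - u \<in> {0<..<1}" using u by auto
    with assms(1) have "ennreal_power (f (\<mu> + x)) (1 - u) * ennreal_power (f (\<mu> + y)) (1 - (1 - u))
        \<le> f ((1 - u) * (\<mu> + x) + (1 - (1 - u)) * (\<mu> + y))"
      unfolding log_concave_fun_def by blast
    then have "(1 - u) * (\<beta> * x + H x) + u * (\<beta> * y + H y)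
        \<le> \<beta> * ((1 - u) * x + u * y) + H ((1 - u) * x + u * y)"
      unfolding eq using xy p
      by (simp add: off_right ennreal_power_exp flip: ennreal_mult exp_add)
    then show "- H ((1 - u) *\<^sub>R x + u *\<^sub>R y) \<le> (1 - u) * - H x + u * - H y"
      by (simp add: algebra_simps)
  qed auto
  show "((\<lambda>r. - H r) has_real_derivative Q r) (at r)" if "r \<in> {0<..}" for r
    using DERIV_minus[OF DERIV_H[of r]] that by simp
qed (use assms in auto)

text \<open>A nondecreasing \<open>Q\<close> is bounded by \<open>Q 1\<close> near 0, so
  \<open>H\<close> stays bounded there and the value at the centre is neither 0 nor
  infinite.\<close>

lemma f_centre_eq_exp:
  assumes "\<And>s t. 0 < s \<Longrightarrow> s \<le> t \<Longrightarrow> Q s \<le> Q t"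
  obtains h where "f \<mu> = ennreal (exp h)" "(H \<longlongrightarrow> h) (at_right 0)"
proof -
  have limR: "((\<lambda>r. f (\<mu> + r)) \<longlongrightarrow> f \<mu>) (at_right 0)"
    using lim by (simp add: filterlim_at_split filterlim_at_right_to_0[of _ _ \<mu>] add.commute)
  have ev: "\<forall>\<^sub>F r in at_right (0::real). r \<in> {0<..<1}"
    by (rule eventually_at_right_real) simp
  have bounds: "ennreal (exp (H 1 - \<bar>\<beta>\<bar>)) \<le> f (\<mu> + r)" "f (\<mu> + r) \<le> ennreal (exp (\<bar>\<beta>\<bar> + H 1 + Q 1))"
    if r: "r \<in> {0<..<1}" for r
  proof -
    have "\<bar>\<beta> * r\<bar> \<le> \<bar>\<beta>\<bar>" using r by (simp add: abs_mult mult_left_le)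
    moreover have "H 1 \<le> H r" using r by (intro H_antimono) auto
    moreover have "Q 1 * r + H r \<le> Q 1 * 1 + H 1" using r by (intro tilted_mono) (auto intro: assms)
    moreover have "0 \<le> Q 1 * r" using r Q_pos[of 1] by simp
    ultimately show "ennreal (exp (H 1 - \<bar>\<beta>\<bar>)) \<le> f (\<mu> + r)" "f (\<mu> + r) \<le> ennreal (exp (\<bar>\<beta>\<bar> + H 1 + Q 1))"
      using r by (auto simp: off_right intro!: ennreal_leI)
  qed
  have "ennreal (exp (H 1 - \<bar>\<beta>\<bar>)) \<le> f \<mu>"
    by (rule tendsto_lowerbound[OF limR]) (use ev bounds in \<open>auto elim: eventually_mono\<close>)
  moreover have "f \<mu> \<le> ennreal (exp (\<bar>\<beta>\<bar> + H 1 + Q 1))"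
    by (rule tendsto_upperbound[OF limR]) (use ev bounds in \<open>auto elim: eventually_mono\<close>)
  ultimately obtain a where a: "f \<mu> = ennreal a" "a > 0"
    by (cases "f \<mu>") (auto simp: top_unique ennreal_le_iff2 intro: less_le_trans[OF exp_gt_zero])
  have "((\<lambda>r. ennreal (exp (\<beta> * r + H r))) \<longlongrightarrow> ennreal a) (at_right 0)"
    by (rule Lim_transform_eventually[OF limR[unfolded a(1)]])
      (use ev in \<open>eventually_elim, simp add: off_right\<close>)
  then have "((\<lambda>r. exp (\<beta> * r + H r)) \<longlongrightarrow> a) (at_right 0)"
    using a(2) by (subst (asm) tendsto_ennreal_iff) auto
  from tendsto_ln[OF this] a(2) have "((\<lambda>r. \<beta> * r + H r) \<longlongrightarrow> ln a) (at_right 0)" by simp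
  from tendsto_diff[OF this tendsto_mult_right_zero[OF tendsto_ident_at, of \<beta>]]
  have "(H \<longlongrightarrow> ln a) (at_right 0)" by simp
  then show ?thesis using a by (intro that[of "ln a"]) auto
qed

lemma mono_imp_log_concave:
  assumes mono: "\<And>s t. 0 < s \<Longrightarrow> s \<le> t \<Longrightarrow> Q s \<le> Q t"
  shows "log_concave_fun f"
proof -
  obtain h where h: "f \<mu> = ennreal (exp h)" "(H \<longlongrightarrow> h) (at_right 0)"
    using f_centre_eq_exp[OF mono] by blast
  \<comment> \<open>\<open>G\<close> extends \<open>H\<close> to 0, so that a single formula for
    \<open>f\<close> covers the centre too.\<close>
  define G where "G r = (if r = 0 then h else H r)" for r
  have f_eq: "f y = ennreal (exp (\<beta> * (y - \<mu>) + G \<bar>y - \<mu>\<bar>))" for y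
    using off[of y] h(1) by (auto simp: G_def)
  \<comment> \<open>Inequalities for \<open>G\<close> on the closed half-line follow from those for
    \<open>H\<close> by translating all arguments by a small \<open>e > 0\<close> and letting
    \<open>e\<close> tend to 0.\<close>
  have shift: "((\<lambda>e. H (c + e)) \<longlongrightarrow> G c) (at_right 0)" if "c \<ge> 0" for c
  proof (cases "c = 0")
    case False
    then have "isCont H c" using that DERIV_H[of c] by (auto intro: DERIV_isCont)
    then have "((\<lambda>e. H (c + e)) \<longlongrightarrow> H c) (at_right 0)"
      by (rule isCont_tendsto_compose) (auto intro!: tendsto_eq_intros)
    then show ?thesis using False by (simp add: G_def)
  qed (use h in \<open>simp add: G_def\<close>)
  have G_anti: "G t \<le> G s" if "0 \<le> s" "s \<le> t" for s t
  proof (rule tendsto_le[OF _ shift shift])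
    show "\<forall>\<^sub>F e in at_right 0. H (t + e) \<le> H (s + e)"
      using eventually_at_right_less[of 0] by eventually_elim (use that in \<open>auto intro: H_antimono\<close>)
  qed (use that in auto)
  have "convex_on {0<..} (\<lambda>r. - H r)"
    using DERIV_minus[OF DERIV_H] mono
    by (intro convex_on_realI[where f' = Q]) auto
  then have H_conc: "u * H s + v * H t \<le> H (u * s + v * t)"
    if "s > 0" "t > 0" "u \<ge> 0" "v \<ge> 0" "u + v = 1" for s t u v
    using that unfolding convex_on_def by force
  have G_conc: "u * G s + v * G t \<le> G (u * s + v * t)"
    if "s \<ge> 0" "t \<ge> 0" and uv: "u \<ge> 0" "v \<ge> 0" "u + v = 1" for s t u v
  proof (rule tendsto_le[OF _ shift])
    show "((\<lambda>e. u * H (s + e) + v * H (t + e)) \<longlongrightarrow> u * G s + v * G t) (at_right 0)"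
      using that by (intro tendsto_intros shift)
    show "\<forall>\<^sub>F e in at_right 0. u * H (s + e) + v * H (t + e) \<le> H (u * s + v * t + e)"
      using eventually_at_right_less[of 0]
    proof eventually_elim
      case (elim e)
      have "u * (s + e) + v * (t + e) = u * s + v * t + (u + v) * e" by (simp add: algebra_simps)
      then show ?case using H_conc[of "s + e" "t + e" u v] that elim by simp
    qed
  qed (use that in auto)
  show ?thesis
    unfolding log_concave_fun_def
  proof (intro allI ballI)
    fix x y \<theta> :: real assume th: "\<theta> \<in> {0<..<1}"
    define z where "z = \<theta> * x + (1 - \<theta>) * y"
    have z: "z - \<mu> = \<theta> * (x - \<mu>) + (1 - \<theta>) * (y - \<mu>)" by (simp add: z_def algebra_simps)
    \<comment> \<open>A concave nonincreasing function of the convex function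
      \<open>\<bar>z - \<mu>\<bar>\<close> is concave in \<open>z\<close>.\<close>
    have "\<bar>z - \<mu>\<bar> \<le> \<bar>\<theta> * (x - \<mu>)\<bar> + \<bar>(1 - \<theta>) * (y - \<mu>)\<bar>" unfolding z by (rule abs_triangle_ineq)
    also have "\<dots> = \<theta> * \<bar>x - \<mu>\<bar> + (1 - \<theta>) * \<bar>y - \<mu>\<bar>" using th by (simp add: abs_mult)
    finally have "G (\<theta> * \<bar>x - \<mu>\<bar> + (1 - \<theta>) * \<bar>y - \<mu>\<bar>) \<le> G \<bar>z - \<mu>\<bar>" by (intro G_anti) auto
    moreover have "\<theta> * G \<bar>x - \<mu>\<bar> + (1 - \<theta>) * G \<bar>y - \<mu>\<bar> \<le> G (\<theta> * \<bar>x - \<mu>\<bar> + (1 - \<theta>) * \<bar>y - \<mu>\<bar>)"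
      using th by (intro G_conc) auto
    ultimately have "\<theta> * (\<beta> * (x - \<mu>) + G \<bar>x - \<mu>\<bar>) + (1 - \<theta>) * (\<beta> * (y - \<mu>) + G \<bar>y - \<mu>\<bar>)
        \<le> \<beta> * (z - \<mu>) + G \<bar>z - \<mu>\<bar>"
      unfolding z by (simp add: algebra_simps)
    then show "ennreal_power (f x) \<theta> * ennreal_power (f y) (1 - \<theta>) \<le> f (\<theta> * x + (1 - \<theta>) * y)"
      unfolding z_def[symmetric] f_eq ennreal_power_exp
      by (simp flip: ennreal_mult exp_add)
  qed
qed

lemma log_concave_iff: "log_concave_fun f \<longleftrightarrow> (\<forall>s t. 0 < s \<longrightarrow> s \<le> t \<longrightarrow> Q s \<le> Q t)"
  using log_concave_imp_mono mono_imp_log_concave by blast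

lemma log_convex_right_iff: "log_convex_on {\<mu><..} f \<longleftrightarrow> (\<forall>s t. 0 < s \<longrightarrow> s \<le> t \<longrightarrow> Q t \<le> Q s)"
proof -
  let ?g = "\<lambda>y. \<beta> * (y - \<mu>) + H (y - \<mu>)"
  have "convex_on {\<mu><..} (\<lambda>y. ln (enn2real (f y))) \<longleftrightarrow> convex_on {\<mu><..} ?g"
    by (rule convex_on_cong_fun) (auto simp: off_right)
  then have iff: "log_convex_on {\<mu><..} f \<longleftrightarrow> convex_on {\<mu><..} ?g"
    by (auto simp: log_convex_on_def off_right)
  have der: "(?g has_real_derivative \<beta> - Q (y - \<mu>)) (at y)" if "y \<in> {\<mu><..}" for y
    using DERIV_tilted[of "y - \<mu>" \<beta>] DERIV_shift[of "\<lambda>r. \<beta> * r + H r" "\<beta> - Q (y - \<mu>)" y "- \<mu>"] that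
    by simp
  show ?thesis
    unfolding iff
  proof safe
    fix s t :: real assume c: "convex_on {\<mu><..} ?g" and "0 < s" "s \<le> t"
    then show "Q t \<le> Q s"
      using convex_on_imp_deriv_mono[OF c _ der, of "\<mu> + s" "\<mu> + t"] by simp
  next
    assume "\<forall>s t. 0 < s \<longrightarrow> s \<le> t \<longrightarrow> Q t \<le> Q s"
    then show "convex_on {\<mu><..} ?g"
      by (intro convex_on_realI[where f' = "\<lambda>y. \<beta> - Q (y - \<mu>)"] der) auto
  qed
qed

text \<open>Reflection keeps \<open>Q\<close> and only changes the sign of the tilt, which convexity
  does not see; both half-lines therefore give the same condition.\<close>

lemma log_convex_iff:
  "log_convex_on {..<\<mu>} f \<and> log_convex_on {\<mu><..} f \<longleftrightarrow> (\<forall>s t. 0 < s \<longrightarrow> s \<le> t \<longrightarrow> Q t \<le> Q s)"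
proof -
  interpret R: tilted_even_density "\<lambda>y. f (2 * \<mu> - y)" \<mu> "- \<beta>" H Q by (rule reflect)
  have "log_convex_on {..<\<mu>} f" if "log_convex_on {\<mu><..} (\<lambda>y. f (2 * \<mu> - y))"
    unfolding log_convex_on_def
  proof (intro conjI ballI convex_onI)
    fix x assume "x \<in> {..<\<mu>}"
    then show "0 < f x" "f x < \<infinity>" by (auto simp: off_left)
  next
    fix u x y :: real assume u: "0 < u" "u < 1" and xy: "x \<in> {..<\<mu>}" "y \<in> {..<\<mu>}"
    have "2 * \<mu> - ((1 - u) * (2 * \<mu> - x) + u * (2 * \<mu> - y)) = (1 - u) * x + u * y"
      by (simp add: algebra_simps)
    moreover have "convex_on {\<mu><..} (\<lambda>y. ln (enn2real (f (2 * \<mu> - y))))"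
      using that by (simp add: log_convex_on_def)
    from convex_onD[OF this, of u "2 * \<mu> - x" "2 * \<mu> - y"] u xy
    have "ln (enn2real (f (2 * \<mu> - ((1 - u) * (2 * \<mu> - x) + u * (2 * \<mu> - y)))))
       \<le> (1 - u) * ln (enn2real (f x)) + u * ln (enn2real (f y))" by simp
    ultimately show "ln (enn2real (f ((1 - u) *\<^sub>R x + u *\<^sub>R y)))
        \<le> (1 - u) * ln (enn2real (f x)) + u * ln (enn2real (f y))" by simp
  qed simp
  then show ?thesis using R.log_convex_right_iff log_convex_right_iff by blast
qed

end

section \<open>Generalized hyperbolic densities\<close>

lemma gh_density_off_centre:
  assumes "gh_density \<mu> lam \<alpha> \<beta> \<delta> f"
  obtains c where "c > 0" "\<And>y. \<delta> \<noteq> 0 \<or> y \<noteq> \<mu> \<Longrightarrow> f y = ennreal (c * gh_kernel \<mu> lam \<alpha> \<beta> \<delta> y)"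
  using assms unfolding gh_density_def by blast

text \<open>For \<open>\<delta> = 0\<close> the limit is part of the definition; otherwise the
  radius is positive at \<open>\<mu>\<close> and the kernel is continuous there.\<close>

lemma gh_density_lim:
  assumes f: "gh_density \<mu> lam \<alpha> \<beta> \<delta> f" and "\<alpha> \<ge> 0"
  shows "(f \<longlongrightarrow> f \<mu>) (at \<mu>)"
proof (cases "\<delta> = 0")
  case True
  then show ?thesis using f by (simp add: gh_density_def)
next
  case False
  obtain c where c: "c > 0" "\<And>y. \<delta> \<noteq> 0 \<or> y \<noteq> \<mu> \<Longrightarrow> f y = ennreal (c * gh_kernel \<mu> lam \<alpha> \<beta> \<delta> y)"
    using gh_density_off_centre[OF f] by blast
  then have f_eq: "f = (\<lambda>y. ennreal (c * gh_kernel \<mu> lam \<alpha> \<beta> \<delta> y))" using False by auto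
  have pos: "\<delta>\<^sup>2 + (\<mu> - \<mu>)\<^sup>2 > 0" using False by simp
  have s: "((\<lambda>y. \<delta>\<^sup>2 + (y - \<mu>)\<^sup>2) \<longlongrightarrow> \<delta>\<^sup>2 + (\<mu> - \<mu>)\<^sup>2) (at \<mu>)"
    by (intro tendsto_intros)
  have powr: "((\<lambda>y. (\<delta>\<^sup>2 + (y - \<mu>)\<^sup>2) powr p) \<longlongrightarrow> (\<delta>\<^sup>2 + (\<mu> - \<mu>)\<^sup>2) powr p) (at \<mu>)" for p
    using pos by (intro tendsto_powr s tendsto_const) simp
  have kernel: "(gh_kernel \<mu> lam \<alpha> \<beta> \<delta> \<longlongrightarrow> gh_kernel \<mu> lam \<alpha> \<beta> \<delta> \<mu>) (at \<mu>)"
  proof (cases "\<alpha> = 0")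
    case True
    then show ?thesis using powr by (simp add: gh_kernel_def[abs_def])
  next
    case \<alpha>: False
    then have "\<alpha> * sqrt (\<delta>\<^sup>2 + (\<mu> - \<mu>)\<^sup>2) > 0"
      using \<open>\<alpha> \<ge> 0\<close> pos by (intro mult_pos_pos) simp_all
    from isCont_tendsto_compose[OF isCont_bessel_K[OF this] tendsto_mult[OF tendsto_const tendsto_real_sqrt[OF s]]]
    show ?thesis
      unfolding gh_kernel_def[abs_def] if_not_P[OF \<alpha>]
      by (intro tendsto_mult tendsto_exp tendsto_diff tendsto_const tendsto_ident_at powr)
  qed
  then have "((\<lambda>y. c * gh_kernel \<mu> lam \<alpha> \<beta> \<delta> y) \<longlongrightarrow> c * gh_kernel \<mu> lam \<alpha> \<beta> \<delta> \<mu>) (at \<mu>)"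
    by (intro tendsto_mult tendsto_const)
  then show ?thesis unfolding f_eq by (rule tendsto_ennrealI)
qed

text \<open>With \<open>r\<close> the radius, the logarithmic derivative
  \<open>nu * y / r\<^sup>2\<close> of the power factor cancels the contribution of
  \<open>nu / x * bessel_K nu x\<close> in \<open>DERIV_bessel_K\<close>; only the ratio of
  consecutive orders is left.\<close>

lemma gh_tilted_even:
  assumes f: "gh_density \<mu> lam \<alpha> \<beta> \<delta> f" and \<alpha>: "\<alpha> > 0"
  obtains H where "tilted_even_density f \<mu> \<beta> H (\<lambda>r. \<alpha> * bessel_slope (lam - 1/2) \<alpha> \<delta> r)"
proof -
  define nu where "nu = lam - 1/2"
  obtain c where c: "c > 0" "\<And>y. \<delta> \<noteq> 0 \<or> y \<noteq> \<mu> \<Longrightarrow> f y = ennreal (c * gh_kernel \<mu> lam \<alpha> \<beta> \<delta> y)"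
    using gh_density_off_centre[OF f] by blast
  let ?r = "\<lambda>y. sqrt (\<delta>\<^sup>2 + y\<^sup>2)"
  define H where "H y = ln c + nu * ln (?r y) + ln (bessel_K nu (\<alpha> * ?r y))" for y
  have "tilted_even_density f \<mu> \<beta> H (\<lambda>r. \<alpha> * bessel_slope nu \<alpha> \<delta> r)"
  proof
    fix y assume y: "y \<noteq> \<mu>"
    have r: "?r (y - \<mu>) > 0" using radius_pos[of "\<bar>y - \<mu>\<bar>" \<delta>] y by simp
    have K: "bessel_K nu (\<alpha> * ?r (y - \<mu>)) > 0" using r \<alpha> by (intro bessel_K_pos) simp
    have "(\<delta>\<^sup>2 + (y - \<mu>)\<^sup>2) powr (nu / 2) = exp (nu * ln (?r (y - \<mu>)))"
      using r y by (simp add: powr_def ln_sqrt)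
    then have "c * gh_kernel \<mu> lam \<alpha> \<beta> \<delta> y = exp (\<beta> * (y - \<mu>) + H \<bar>y - \<mu>\<bar>)"
      using \<alpha> c(1) K by (simp add: gh_kernel_def H_def exp_add flip: nu_def)
    then show "f y = ennreal (exp (\<beta> * (y - \<mu>) + H \<bar>y - \<mu>\<bar>))" using c(2)[of y] y by simp
  next
    show "(f \<longlongrightarrow> f \<mu>) (at \<mu>)" using gh_density_lim[OF f] \<alpha> by simp
  next
    fix y :: real assume y: "y > 0"
    have r: "?r y > 0" using radius_pos[OF y, of \<delta>] by simp
    have dr: "(?r has_real_derivative y / ?r y) (at y)"
      by (rule DERIV_radius[OF radius_pos[OF y]])
    have ar: "\<alpha> * ?r y > 0" using r \<alpha> by simp
    let ?K = "bessel_K nu (\<alpha> * ?r y)" and ?L = "bessel_K (nu - 1) (\<alpha> * ?r y)"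
    have K: "?K > 0" using ar by (rule bessel_K_pos)
    have dK: "((\<lambda>y. bessel_K nu (\<alpha> * ?r y)) has_real_derivative
        (- ?L - nu / (\<alpha> * ?r y) * ?K) * (\<alpha> * (y / ?r y))) (at y)"
      by (rule DERIV_chain2[OF DERIV_bessel_K[OF ar] DERIV_cmult[OF dr]])
    have "(H has_real_derivative 0 + nu * (1 / ?r y * (y / ?r y))
        + 1 / ?K * ((- ?L - nu / (\<alpha> * ?r y) * ?K) * (\<alpha> * (y / ?r y)))) (at y)"
      unfolding H_def[abs_def]
      by (intro DERIV_add DERIV_const DERIV_cmult DERIV_chain2[OF DERIV_ln_divide[OF r] dr]
          DERIV_chain2[OF DERIV_ln_divide[OF K] dK])
    moreover have "0 + nu * (1 / ?r y * (y / ?r y))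
        + 1 / ?K * ((- ?L - nu / (\<alpha> * ?r y) * ?K) * (\<alpha> * (y / ?r y)))
      = - (\<alpha> * bessel_slope nu \<alpha> \<delta> y)"
      unfolding bessel_slope_def bessel_ratio_def
    proof -
      define s k l where "s = ?r y" and "k = ?K" and "l = ?L"
      have "s > 0" "k > 0" using r K by (auto simp: s_def k_def)
      then have "0 + nu * (1 / s * (y / s)) + 1 / k * ((- l - nu / (\<alpha> * s) * k) * (\<alpha> * (y / s)))
        = - (\<alpha> * (y / s * (l / k)))"
        using \<alpha> by (simp add: field_simps)
      then show "0 + nu * (1 / ?r y * (y / ?r y)) + 1 / ?K * ((- ?L - nu / (\<alpha> * ?r y) * ?K) * (\<alpha> * (y / ?r y)))
        = - (\<alpha> * (y / ?r y * (?L / ?K)))"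
        unfolding s_def k_def l_def .
    qed
    ultimately show "(H has_real_derivative - (\<alpha> * bessel_slope nu \<alpha> \<delta> y)) (at y)" by (simp only:)
    show "0 < \<alpha> * bessel_slope nu \<alpha> \<delta> y" using bessel_slope_pos[OF \<alpha> y] \<alpha> by simp
  qed
  then show ?thesis using that by (simp add: nu_def)
qed

text \<open>In the power case the decay rate tends to 0 at infinity instead of a positive limit, so
  it is an explicit function treated apart from \<open>bessel_slope\<close>.\<close>

lemma gh_tilted_even_0:
  assumes f: "gh_density \<mu> lam 0 0 \<delta> f" and "lam < 1/2"
  obtains H where "tilted_even_density f \<mu> 0 H (\<lambda>r. (1 - 2 * lam) * (r / (\<delta>\<^sup>2 + r\<^sup>2)))"
proof -
  obtain c where c: "c > 0" "\<And>y. \<delta> \<noteq> 0 \<or> y \<noteq> \<mu> \<Longrightarrow> f y = ennreal (c * gh_kernel \<mu> lam 0 0 \<delta> y)"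
    using gh_density_off_centre[OF f] by blast
  define H where "H y = ln c + (lam - 1/2) * ln (\<delta>\<^sup>2 + y\<^sup>2)" for y
  have "tilted_even_density f \<mu> 0 H (\<lambda>r. (1 - 2 * lam) * (r / (\<delta>\<^sup>2 + r\<^sup>2)))"
  proof
    fix y assume y: "y \<noteq> \<mu>"
    have "\<delta>\<^sup>2 + (y - \<mu>)\<^sup>2 > 0" using radius_pos[of "\<bar>y - \<mu>\<bar>" \<delta>] y by simp
    then have "c * gh_kernel \<mu> lam 0 0 \<delta> y = exp (0 * (y - \<mu>) + H \<bar>y - \<mu>\<bar>)"
      using c(1) y by (simp add: gh_kernel_def H_def exp_add powr_def)
    then show "f y = ennreal (exp (0 * (y - \<mu>) + H \<bar>y - \<mu>\<bar>))" using c(2)[of y] y by simp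
  next
    show "(f \<longlongrightarrow> f \<mu>) (at \<mu>)" using gh_density_lim[OF f] by simp
  next
    fix y :: real assume y: "y > 0"
    note pos = radius_pos[OF y, of \<delta>]
    show "(H has_real_derivative - ((1 - 2 * lam) * (y / (\<delta>\<^sup>2 + y\<^sup>2)))) (at y)"
    proof (rule DERIV_cong)
      show "(H has_real_derivative (lam - 1/2) * (1 / (\<delta>\<^sup>2 + y\<^sup>2) * (2 * y))) (at y)"
        unfolding H_def[abs_def] using pos by (auto intro!: derivative_eq_intros)
      have "(lam - 1/2) * (1 / s * (2 * y)) = - ((1 - 2 * lam) * (y / s))" if "s > 0" for s
        using that by (simp add: field_simps)
      then show "(lam - 1/2) * (1 / (\<delta>\<^sup>2 + y\<^sup>2) * (2 * y)) = - ((1 - 2 * lam) * (y / (\<delta>\<^sup>2 + y\<^sup>2)))"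
        using pos by blast
    qed
    show "0 < (1 - 2 * lam) * (y / (\<delta>\<^sup>2 + y\<^sup>2))" using pos y \<open>lam < 1/2\<close> by simp
  qed
  then show ?thesis using that by blast
qed

section \<open>Level crossings and monotonicity of the slope in terms of the parameters\<close>

context
  fixes \<alpha> :: real
  assumes \<alpha>: "\<alpha> > 0"
begin

text \<open>A level \<open>b < 1\<close> is reached because the slope tends to 1; for
  \<open>b = 1\<close> necessarily \<open>lam < 1\<close>, and the slope exceeds 1 somewhere. Once
  reached, the level is kept.\<close>

lemma slope_crossing:
  assumes "lam \<ge> 1 \<or> \<delta> \<noteq> 0" "b \<le> 1" "lam < 1 \<or> b < 1"
  shows "\<exists>x\<ge>0. (\<forall>r. 0 < r \<longrightarrow> r < x \<longrightarrow> bessel_slope (lam - 1/2) \<alpha> \<delta> r \<le> b)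
    \<and> (\<forall>r>x. b \<le> bessel_slope (lam - 1/2) \<alpha> \<delta> r)"
proof -
  let ?P = "bessel_slope (lam - 1/2) \<alpha> \<delta>"
  have "\<exists>x0>0. b \<le> ?P x0"
  proof (cases "b < 1")
    case True
    then have "\<forall>\<^sub>F y in at_top. b < ?P y"
      by (intro order_tendstoD(1)[OF tendsto_bessel_slope] \<alpha>)
    with eventually_gt_at_top[of 0] have "\<forall>\<^sub>F y in at_top. 0 < y \<and> b \<le> ?P y"
      by eventually_elim auto
    then show ?thesis by (rule eventually_happens'[rotated]) auto
  next
    case False
    then show ?thesis using bessel_slope_exceeds_1[OF \<alpha>, of "lam - 1/2" \<delta>] assms by force
  qed
  then obtain x0 where "x0 > 0" "b \<le> ?P x0" by blast
  have stays: "b \<le> ?P y" if "0 < x" "x \<le> y" "b \<le> ?P x" for x y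
    by (rule bessel_slope_stays_above[OF \<alpha> _ _ that]) (use assms in auto)
  show ?thesis
    by (rule crossing_point[where P = ?P, OF _ \<open>x0 > 0\<close> \<open>b \<le> ?P x0\<close>]) (rule stays)
qed

text \<open>This lets any nonzero tilt outweigh the slope near the centre, which rules out a mode at
  \<open>\<mu>\<close>.\<close>

lemma slope_small_near_0:
  assumes "lam > 1 \<or> \<delta> \<noteq> 0" "L > 0"
  shows "\<exists>r>0. bessel_slope (lam - 1/2) \<alpha> \<delta> r < L"
proof (cases "\<delta> = 0")
  case True
  with bessel_ratio_small_near_0[of "lam - 1/2" L] assms obtain z
    where "z > 0" "bessel_ratio (lam - 1/2) z < L" by auto
  then show ?thesis using True \<alpha> by (intro exI[of _ "z / \<alpha>"]) (simp add: bessel_slope_0[OF \<alpha>])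
next
  case False
  have "\<forall>\<^sub>F r in at_right 0. bessel_slope (lam - 1/2) \<alpha> \<delta> r < L"
    by (rule order_tendstoD(2)[OF tendsto_bessel_slope_0[OF \<alpha> False] \<open>L > 0\<close>])
  with eventually_at_right_less[of 0] have "\<forall>\<^sub>F r in at_right 0. r > 0 \<and> bessel_slope (lam - 1/2) \<alpha> \<delta> r < L"
    by eventually_elim auto
  then show ?thesis by (rule eventually_happens'[rotated]) auto
qed

text \<open>For \<open>lam < 1\<close> monotonicity fails in one of two ways: with
  \<open>\<delta> = 0\<close> the slope is a strictly decreasing ratio, otherwise it exceeds its own
  limit 1 somewhere.\<close>

lemma slope_mono_iff:
  "(\<forall>s t. 0 < s \<longrightarrow> s \<le> t \<longrightarrow> bessel_slope (lam - 1/2) \<alpha> \<delta> s \<le> bessel_slope (lam - 1/2) \<alpha> \<delta> t) \<longleftrightarrow> lam \<ge> 1"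
proof
  let ?P = "bessel_slope (lam - 1/2) \<alpha> \<delta>"
  assume mono: "\<forall>s t. 0 < s \<longrightarrow> s \<le> t \<longrightarrow> ?P s \<le> ?P t"
  show "lam \<ge> 1"
  proof (rule ccontr)
    assume "\<not> lam \<ge> 1"
    then have nu: "lam - 1/2 < 1/2" by simp
    show False
    proof (cases "\<delta> = 0")
      case True
      then show False
        using bessel_ratio_strict_antimono[OF nu, of \<alpha> "\<alpha> * 2"] mono[rule_format, of 1 2] \<alpha>
        by (simp add: bessel_slope_0[OF \<alpha>])
    next
      case False
      obtain y where y: "y > 0" "?P y > 1" using bessel_slope_exceeds_1[OF \<alpha> nu False] by blast
      have "?P y \<le> 1"
      proof (rule tendsto_lowerbound[OF tendsto_bessel_slope[OF \<alpha>, of "lam - 1/2" \<delta>]])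
        show "\<forall>\<^sub>F t in at_top. ?P y \<le> ?P t"
          using eventually_ge_at_top[of y] by eventually_elim (use mono y in auto)
      qed auto
      with y show False by simp
    qed
  qed
qed (auto intro: bessel_slope_mono[OF \<alpha>])

text \<open>For \<open>\<delta> \<noteq> 0\<close> a positive slope that starts from the limit 0
  cannot be nonincreasing; for \<open>\<delta> = 0\<close> the slope is the ratio, which strictly
  increases when \<open>lam > 1\<close>.\<close>

lemma slope_antimono_iff:
  "(\<forall>s t. 0 < s \<longrightarrow> s \<le> t \<longrightarrow> bessel_slope (lam - 1/2) \<alpha> \<delta> t \<le> bessel_slope (lam - 1/2) \<alpha> \<delta> s)
    \<longleftrightarrow> \<delta> = 0 \<and> lam \<le> 1"
proof
  let ?P = "bessel_slope (lam - 1/2) \<alpha> \<delta>"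
  assume anti: "\<forall>s t. 0 < s \<longrightarrow> s \<le> t \<longrightarrow> ?P t \<le> ?P s"
  have "\<delta> = 0"
  proof (rule ccontr)
    assume "\<delta> \<noteq> 0"
    have "?P 1 \<le> 0"
    proof (rule tendsto_lowerbound[OF tendsto_bessel_slope_0[OF \<alpha> \<open>\<delta> \<noteq> 0\<close>]])
      show "\<forall>\<^sub>F r in at_right 0. ?P 1 \<le> ?P r"
        using eventually_at_right_real[of 0 1] anti by (auto elim: eventually_mono)
    qed auto
    then show False using bessel_slope_pos[OF \<alpha>, of 1 "lam - 1/2" \<delta>] by simp
  qed
  moreover have "lam \<le> 1"
    using bessel_ratio_strict_mono[of "lam - 1/2" \<alpha> "\<alpha> * 2"] anti[rule_format, of 1 2] \<alpha> \<open>\<delta> = 0\<close>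
    by (cases "lam \<le> 1") (auto simp: bessel_slope_0[OF \<alpha>])
  ultimately show "\<delta> = 0 \<and> lam \<le> 1" ..
next
  assume "\<delta> = 0 \<and> lam \<le> 1"
  then show "\<forall>s t. 0 < s \<longrightarrow> s \<le> t \<longrightarrow> bessel_slope (lam - 1/2) \<alpha> \<delta> t \<le> bessel_slope (lam - 1/2) \<alpha> \<delta> s"
    using \<alpha> by (auto simp: bessel_slope_0[OF \<alpha>] intro!: bessel_ratio_antimono)
qed

end

theorem corollary1:
  fixes \<mu> lam \<alpha> \<beta> \<delta> :: real and f :: "real \<Rightarrow> ennreal"
  assumes pos: "lam > 0 \<Longrightarrow> \<delta> \<ge> 0 \<and> \<bar>\<beta>\<bar> < \<alpha>"
    and zero: "lam = 0 \<Longrightarrow> \<delta> > 0 \<and> \<bar>\<beta>\<bar> < \<alpha>"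
    and neg: "lam < 0 \<Longrightarrow> \<delta> > 0 \<and> \<bar>\<beta>\<bar> \<le> \<alpha>"
    and f: "gh_density \<mu> lam \<alpha> \<beta> \<delta> f"
  shows "unimodal f
    \<and> (is_mode f \<mu> \<longleftrightarrow> \<beta> = 0 \<or> (\<delta> = 0 \<and> 0 < lam \<and> lam \<le> 1))
    \<and> (log_concave_fun f \<longleftrightarrow> lam \<ge> 1)
    \<and> (log_convex_on {..<\<mu>} f \<and> log_convex_on {\<mu><..} f \<longleftrightarrow> \<delta> = 0 \<and> 0 < lam \<and> lam \<le> 1)"
proof (cases "\<alpha> = 0")
  case True
  have "lam < 0" using True pos zero by (cases lam "0::real" rule: linorder_cases) auto
  then have params: "lam < 0" "\<delta> > 0" "\<beta> = 0" using True neg by auto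
  obtain H where "tilted_even_density f \<mu> 0 H (\<lambda>r. (1 - 2 * lam) * (r / (\<delta>\<^sup>2 + r\<^sup>2)))"
    using gh_tilted_even_0[of \<mu> lam \<delta> f] f params True by auto
  then interpret tilted_even_density f \<mu> 0 H "\<lambda>r. (1 - 2 * lam) * (r / (\<delta>\<^sup>2 + r\<^sup>2))" .
  \<comment> \<open>\<open>r / (\<delta>\<^sup>2 + r\<^sup>2)\<close> peaks at
    \<open>r = \<delta>\<close> and takes equal values at \<open>\<delta> / 2\<close> and
    \<open>2 * \<delta>\<close>; these three points refute monotonicity in both directions.\<close>
  have ratio: "\<delta> / (\<delta>\<^sup>2 + \<delta>\<^sup>2) = 1 / (2 * \<delta>)" "2 * \<delta> / (\<delta>\<^sup>2 + (2 * \<delta>)\<^sup>2) = 2 / (5 * \<delta>)"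
    "\<delta> / 2 / (\<delta>\<^sup>2 + (\<delta> / 2)\<^sup>2) = 2 / (5 * \<delta>)"
    using params by (auto simp: field_simps power2_eq_square)
  have lt: "(1 - 2 * lam) * (2 / (5 * \<delta>)) < (1 - 2 * lam) * (1 / (2 * \<delta>))"
    using params by (intro mult_strict_left_mono) (auto simp: field_simps)
  have "is_mode f \<mu>" unfolding is_mode_centre_iff using Q_pos by (auto intro: less_imp_le)
  moreover have "\<not> log_concave_fun f"
  proof
    assume "log_concave_fun f"
    from log_concave_imp_mono[OF this, of \<delta> "2 * \<delta>"] params lt show False unfolding ratio by simp
  qed
  moreover have "\<not> (log_convex_on {..<\<mu>} f \<and> log_convex_on {\<mu><..} f)"
  proof
    assume "log_convex_on {..<\<mu>} f \<and> log_convex_on {\<mu><..} f"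
    then have "(1 - 2 * lam) * (\<delta> / (\<delta>\<^sup>2 + \<delta>\<^sup>2)) \<le> (1 - 2 * lam) * (\<delta> / 2 / (\<delta>\<^sup>2 + (\<delta> / 2)\<^sup>2))"
      unfolding log_convex_iff by (elim allE[of _ "\<delta> / 2"] allE[of _ \<delta>] impE) (use params in auto)
    with lt show False unfolding ratio by simp
  qed
  ultimately show ?thesis using params by (auto simp: unimodal_def)
next
  case False
  with pos zero neg have \<alpha>: "\<alpha> > 0" by (cases lam "0::real" rule: linorder_cases) auto
  let ?P = "bessel_slope (lam - 1/2) \<alpha> \<delta>" and ?b = "\<bar>\<beta>\<bar> / \<alpha>"
  obtain H where "tilted_even_density f \<mu> \<beta> H (\<lambda>r. \<alpha> * ?P r)"
    using gh_tilted_even[OF f \<alpha>] by blast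
  then interpret tilted_even_density f \<mu> \<beta> H "\<lambda>r. \<alpha> * ?P r" .
  have "\<bar>\<beta>\<bar> \<le> \<alpha> \<and> (lam < 0 \<or> \<bar>\<beta>\<bar> < \<alpha>)"
    using pos zero neg by (cases lam "0::real" rule: linorder_cases) auto
  then have b: "?b \<le> 1" "lam < 0 \<or> ?b < 1" using \<alpha> by auto
  have level: "\<bar>\<beta>\<bar> \<le> \<alpha> * ?P r \<longleftrightarrow> ?b \<le> ?P r" "\<alpha> * ?P r \<le> \<bar>\<beta>\<bar> \<longleftrightarrow> ?P r \<le> ?b" for r
    using \<alpha> by (auto simp: field_simps)
  have \<delta>0: "0 < lam" if "\<delta> = 0"
    using that pos zero neg by (cases lam "0::real" rule: linorder_cases) auto
  have mode: "is_mode f \<mu> \<longleftrightarrow> \<beta> = 0 \<or> (\<delta> = 0 \<and> lam \<le> 1)"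
  proof
    assume "is_mode f \<mu>"
    then have "?b \<le> ?P r" if "r > 0" for r using that by (simp add: is_mode_centre_iff level)
    then show "\<beta> = 0 \<or> (\<delta> = 0 \<and> lam \<le> 1)"
      using slope_small_near_0[OF \<alpha>, of lam \<delta> ?b] \<alpha> by (meson divide_pos_pos not_less zero_less_abs_iff)
  next
    assume cases: "\<beta> = 0 \<or> (\<delta> = 0 \<and> lam \<le> 1)"
    have "?b \<le> ?P r" if r: "r > 0" for r
      using cases
    proof (elim disjE conjE)
      assume "\<beta> = 0"
      then show ?thesis using bessel_slope_pos[OF \<alpha> r, of "lam - 1/2" \<delta>] by simp
    next
      assume "\<delta> = 0" "lam \<le> 1"
      then have "1 \<le> ?P r"
        using \<alpha> r bessel_ratio_ge_1[of "lam - 1/2" "\<alpha> * r"] by (simp add: bessel_slope_0[OF \<alpha>])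
      then show ?thesis using b(1) by linarith
    qed
    then show "is_mode f \<mu>" by (simp add: is_mode_centre_iff level(1))
  qed
  have "unimodal f"
  proof (cases "\<delta> = 0 \<and> lam < 1")
    case True
    then have "is_mode f \<mu>" using mode by simp
    then show ?thesis by (auto simp: unimodal_def)
  next
    case False
    have "\<exists>x\<ge>0. (\<forall>r. 0 < r \<longrightarrow> r < x \<longrightarrow> ?P r \<le> ?b) \<and> (\<forall>r>x. ?b \<le> ?P r)"
      by (rule slope_crossing[OF \<alpha>]) (use b False in auto)
    then obtain x where "x \<ge> 0" "\<And>r. 0 < r \<Longrightarrow> r < x \<Longrightarrow> ?P r \<le> ?b" "\<And>r. x < r \<Longrightarrow> ?b \<le> ?P r"
      by blast
    then show ?thesis using unimodal_crossing[of x] level by blast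
  qed
  moreover have "log_concave_fun f \<longleftrightarrow> lam \<ge> 1"
    by (simp only: log_concave_iff mult_le_cancel_left_pos[OF \<alpha>] slope_mono_iff[OF \<alpha>])
  moreover have "log_convex_on {..<\<mu>} f \<and> log_convex_on {\<mu><..} f \<longleftrightarrow> \<delta> = 0 \<and> lam \<le> 1"
    by (simp only: log_convex_iff mult_le_cancel_left_pos[OF \<alpha>] slope_antimono_iff[OF \<alpha>])
  \<comment> \<open>The parameter constraints admit \<open>\<delta> = 0\<close> only together with
    \<open>lam > 0\<close>.\<close>
  moreover have "\<delta> = 0 \<and> lam \<le> 1 \<longleftrightarrow> \<delta> = 0 \<and> 0 < lam \<and> lam \<le> 1"
    using \<delta>0 by auto
  ultimately show ?thesis using mode by (simp only: simp_thms)
qed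

end
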